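(* Let $X$ be a Hilbert $C^*$-module over a $C^*$-algebra $\mathsf{A}$. Then a sequence $(x_n)_n$ of elements of $X$ is a Parseval frame for $X$ if and only if the sequence $\left(\sum_{n=1}^N\theta_{x_n,x_n}\right)_{N}$ is an approximate unit for $\mathbb{K}(X)$.
   Context: $\mathsf{A}$ is an arbitrary $C^*$-algebra (not necessarily unital). Hilbert $\mathsf{A}$-modules are right modules with $\mathsf{A}$-valued inner product $\langle\cdot,\cdot\rangle$ that is $\mathsf{A}$-linear in the second variable; they are not assumed to be full. For $x,y\in X$, $\theta_{y,x}$ is the adjointable operator on $X$ given by $\theta_{y,x}(z)=y\langle x,z\rangle$; $\mathbb{F}(X)$ is the linear span of all $\theta_{y,x}$ and $\mathbb{K}(X)$ is its norm closure (a $C^*$-algebra). A sequence $(x_n)_n$ in $X$ is a Parseval frame for $X$ if $\sum_{n=1}^{\infty}\langle x,x_n\rangle\langle x_n,x\rangle=\langle x,x\rangle$ for all $x\in X$, with norm convergence of the series. An approximate unit for a $C^*$-algebra $\mathsf{B}$ is a net $(e_\lambda)_\lambda$ of positive elements of the closed unit ball of $\mathsf{B}$ with $\lim_\lambda e_\lambda b=b$ in norm for all $b\in\mathsf{B}$. *)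

theory Defs
  imports "HOL-Analysis.Analysis"
begin

section \<open>Complex normed spaces\<close>

class scaleC =
  fixes scaleC :: "complex \<Rightarrow> 'a \<Rightarrow> 'a" (infixr "*\<^sub>C" 75)

class complex_vector = real_vector + scaleC +
  assumes scaleC_add_right: "c *\<^sub>C (x + y) = c *\<^sub>C x + c *\<^sub>C y"
    and scaleC_add_left: "(c + d) *\<^sub>C x = c *\<^sub>C x + d *\<^sub>C x"
    and scaleC_scaleC: "c *\<^sub>C d *\<^sub>C x = (c * d) *\<^sub>C x"
    and scaleC_one: "1 *\<^sub>C x = x"
    and scaleR_scaleC: "r *\<^sub>R x = complex_of_real r *\<^sub>C x"

global_interpretation complex_vector: vector_space "scaleC :: complex \<Rightarrow> 'a \<Rightarrow> 'a::complex_vector"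
  defines cspan = complex_vector.span
  by unfold_locales
    (simp_all add: scaleC_add_right scaleC_add_left scaleC_scaleC scaleC_one)

class complex_normed_vector = real_normed_vector + complex_vector +
  assumes norm_scaleC: "norm (c *\<^sub>C x) = cmod c * norm x"

lemma bounded_linear_scaleC_right:
  "bounded_linear (\<lambda>x::'a::complex_normed_vector. c *\<^sub>C x)"
proof (rule bounded_linear_intro[where K = "cmod c"])
  fix r :: real and x :: 'a
  show "c *\<^sub>C (r *\<^sub>R x) = r *\<^sub>R (c *\<^sub>C x)"
    by (simp add: scaleR_scaleC scaleC_scaleC mult.commute)
qed (simp_all add: scaleC_add_right norm_scaleC)

instantiation blinfun :: (real_normed_vector, complex_normed_vector) complex_vector
begin

lift_definition scaleC_blinfun :: "complex \<Rightarrow> 'a \<Rightarrow>\<^sub>L 'b \<Rightarrow> 'a \<Rightarrow>\<^sub>L 'b"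
  is "\<lambda>c f x. c *\<^sub>C f x"
  by (rule bounded_linear_compose[OF bounded_linear_scaleC_right])

instance
  by standard
    (transfer; simp add: fun_eq_iff scaleC_add_right scaleC_add_left scaleC_scaleC scaleC_one
      scaleR_scaleC)+

end


section \<open>C*-algebras\<close>

text \<open>No unit is required; the zero algebra is admitted.\<close>

class cstar_algebra = complex_normed_vector + real_normed_algebra + complete_space +
  fixes star :: "'a \<Rightarrow> 'a"
  assumes mult_scaleC_left: "(c *\<^sub>C a) * b = c *\<^sub>C (a * b)"
    and mult_scaleC_right: "a * (c *\<^sub>C b) = c *\<^sub>C (a * b)"
    and star_add: "star (a + b) = star a + star b"
    and star_scaleC: "star (c *\<^sub>C a) = cnj c *\<^sub>C star a"
    and star_mult: "star (a * b) = star b * star a"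
    and star_star: "star (star a) = a"
    and cstar_identity: "norm (star a * a) = (norm a)\<^sup>2"

text \<open>
  The next two notions are stated for a C*-algebra given by a carrier set \<open>B\<close> in a normed space,
  a product and an involution, so that they apply both to a whole type and to an algebra of
  operators. A net is given by a family together with the filter of its index set
  (\<^const>\<open>sequentially\<close> for a sequence).
\<close>

definition positive_in :: "'b set \<Rightarrow> ('b \<Rightarrow> 'b \<Rightarrow> 'b) \<Rightarrow> ('b \<Rightarrow> 'b) \<Rightarrow> 'b \<Rightarrow> bool"
  where "positive_in B prd adj a \<longleftrightarrow> (\<exists>b\<in>B. a = prd (adj b) b)"

definition approximate_unit ::
    "'b::real_normed_vector set \<Rightarrow> ('b \<Rightarrow> 'b \<Rightarrow> 'b) \<Rightarrow> ('b \<Rightarrow> 'b) \<Rightarrow> 'i filter \<Rightarrow> ('i \<Rightarrow> 'b) \<Rightarrow> bool"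
  where "approximate_unit B prd adj F e \<longleftrightarrow>
    (\<forall>i. e i \<in> B \<and> positive_in B prd adj (e i) \<and> norm (e i) \<le> 1) \<and>
    (\<forall>b\<in>B. ((\<lambda>i. prd (e i) b) \<longlongrightarrow> b) F)"


section \<open>Hilbert C*-modules\<close>

text \<open>
  The norm of the type \<open>'x\<close> is required to be the one induced by the inner product, and
  completeness is the class constraint \<^class>\<open>complete_space\<close>.
\<close>

locale hilbert_module =
  fixes act :: "'x::{complex_normed_vector, complete_space} \<Rightarrow> 'a::cstar_algebra \<Rightarrow> 'x"
      (infixl "\<cdot>" 75)
    and ip :: "'x \<Rightarrow> 'x \<Rightarrow> 'a"
  assumes act_add_left: "(x + y) \<cdot> a = x \<cdot> a + y \<cdot> a"
    and act_add_right: "x \<cdot> (a + b) = x \<cdot> a + x \<cdot> b"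
    and act_mult: "x \<cdot> (a * b) = x \<cdot> a \<cdot> b"
    and act_scaleC_left: "(c *\<^sub>C x) \<cdot> a = c *\<^sub>C (x \<cdot> a)"
    and act_scaleC_right: "x \<cdot> (c *\<^sub>C a) = c *\<^sub>C (x \<cdot> a)"
    and ip_add_right: "ip x (y + z) = ip x y + ip x z"
    and ip_scaleC_right: "ip x (c *\<^sub>C y) = c *\<^sub>C ip x y"
    and ip_act_right: "ip x (y \<cdot> a) = ip x y * a"
    and ip_star: "star (ip x y) = ip y x"
    and ip_positive: "positive_in UNIV (*) star (ip x x)"
    and ip_definite: "ip x x = 0 \<Longrightarrow> x = 0"
    and norm_eq_sqrt_ip: "norm x = sqrt (norm (ip x x))"
begin

definition theta :: "'x \<Rightarrow> 'x \<Rightarrow> 'x \<Rightarrow>\<^sub>L 'x"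
  where "theta y x = Blinfun (\<lambda>z. y \<cdot> ip x z)"

definition finite_rank_ops :: "('x \<Rightarrow>\<^sub>L 'x) set"
  where "finite_rank_ops = cspan {theta y x | y x. True}"

definition compact_ops :: "('x \<Rightarrow>\<^sub>L 'x) set"
  where "compact_ops = closure finite_rank_ops"

text \<open>The adjoint is unique when it exists; it exists for all elements of \<open>compact_ops\<close>.\<close>

definition adjoint_op :: "('x \<Rightarrow>\<^sub>L 'x) \<Rightarrow> ('x \<Rightarrow>\<^sub>L 'x)"
  where "adjoint_op T = (THE S. \<forall>x y. ip (blinfun_apply T x) y = ip x (blinfun_apply S y))"

definition parseval_frame :: "(nat \<Rightarrow> 'x) \<Rightarrow> bool"
  where "parseval_frame xs \<longleftrightarrow> (\<forall>x. (\<lambda>n. ip x (xs n) * ip (xs n) x) sums ip x x)"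


subsection \<open>The operators \<open>theta y x\<close> are bounded and adjointable\<close>

lemma norm_star: "norm (star a) = norm (a::'a)"
proof -
  have le: "norm b \<le> norm (star b)" for b :: 'a
  proof (cases "b = 0")
    case False
    have "norm b * norm b \<le> norm (star b) * norm b"
      using norm_mult_ineq[of "star b" b] by (simp add: cstar_identity power2_eq_square)
    then show ?thesis using False by simp
  qed simp
  show ?thesis using le[of a] le[of "star a"] by (simp add: star_star)
qed

lemma norm_ip_self: "norm (ip x x) = (norm x)\<^sup>2"
  by (simp add: norm_eq_sqrt_ip)

lemma ip_add_left: "ip (x + y) z = ip x z + ip y z"
  by (metis ip_star ip_add_right star_add)

lemma ip_scaleC_left: "ip (c *\<^sub>C x) z = cnj c *\<^sub>C ip x z"
  by (metis ip_star ip_scaleC_right star_scaleC)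

lemma ip_act_left: "ip (x \<cdot> a) z = star a * ip x z"
  by (metis ip_star ip_act_right star_mult)

lemma ip_zero_right: "ip x 0 = 0"
  using ip_add_right[of x 0 0] by simp

lemma ip_diff_right: "ip x (y - z) = ip x y - ip x z"
  using ip_add_right[of x "y - z" z] by (simp add: algebra_simps)

lemma norm_act_le: "norm (x \<cdot> a) \<le> norm x * norm a"
proof (rule power2_le_imp_le)
  have "(norm (x \<cdot> a))\<^sup>2 = norm (star a * ip x x * a)"
    by (simp add: norm_ip_self[symmetric] ip_act_right ip_act_left)
  also have "\<dots> \<le> norm (star a) * norm (ip x x) * norm a"
    by (meson norm_mult_ineq mult_right_mono norm_ge_zero order_trans)
  also have "\<dots> = (norm x * norm a)\<^sup>2"
    by (simp add: norm_star norm_ip_self power2_eq_square)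
  finally show "(norm (x \<cdot> a))\<^sup>2 \<le> (norm x * norm a)\<^sup>2" .
qed simp

text \<open>A crude bound from polarisation.\<close>

lemma norm_ip_le_unit:
  assumes "norm x \<le> 1" "norm y \<le> 1"
  shows "norm (ip x y) \<le> 4"
proof -
  define q where "q c = ip (c *\<^sub>C x + y) (c *\<^sub>C x + y)" for c
  have q: "q c = (cnj c * c) *\<^sub>C ip x x + cnj c *\<^sub>C ip x y + c *\<^sub>C ip y x + ip y y" for c
    by (simp add: q_def ip_add_left ip_add_right ip_scaleC_left ip_scaleC_right scaleC_add_right
        scaleC_scaleC mult.commute)
  have nq: "norm (q c) \<le> 4" if "cmod c = 1" for c
  proof -
    have "norm (c *\<^sub>C x + y) \<le> 2"
      using norm_triangle_ineq[of "c *\<^sub>C x" y] assms that by (simp add: norm_scaleC)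
    then have "(norm (c *\<^sub>C x + y))\<^sup>2 \<le> 2\<^sup>2" by (intro power_mono) auto
    then show ?thesis by (simp add: q_def norm_ip_self)
  qed
  have "1 *\<^sub>C q 1 + (-1) *\<^sub>C q (-1) + \<i> *\<^sub>C q \<i> + (-\<i>) *\<^sub>C q (-\<i>) = 4 *\<^sub>C ip x y"
  proof -
    let ?p = "ip x y"
    have four: "4 *\<^sub>C ?p = ?p + ?p + ?p + ?p"
      using scaleC_add_left[of 1 1 ?p] scaleC_add_left[of 2 2 ?p]
      by (simp add: scaleC_one algebra_simps)
    show ?thesis
      unfolding four
      by (simp add: q scaleC_add_right scaleC_scaleC scaleC_one
          complex_vector.scale_minus_left complex_vector.scale_right_diff_distrib)
  qed
  then have "norm (4 *\<^sub>C ip x y) = norm (1 *\<^sub>C q 1 + (-1) *\<^sub>C q (-1) + \<i> *\<^sub>C q \<i> + (-\<i>) *\<^sub>C q (-\<i>))"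
    by simp
  also have "\<dots> \<le> norm (1 *\<^sub>C q 1) + norm ((-1) *\<^sub>C q (-1)) + norm (\<i> *\<^sub>C q \<i>) + norm ((-\<i>) *\<^sub>C q (-\<i>))"
    by (meson norm_triangle_ineq add_right_mono order_trans)
  also have "\<dots> \<le> 16"
    unfolding norm_scaleC using nq[of 1] nq[of "-1"] nq[of \<i>] nq[of "-\<i>"] by simp
  finally show ?thesis by (simp add: norm_scaleC)
qed

lemma norm_ip_le: "norm (ip x y) \<le> 4 * (norm x * norm y)"
proof (cases "x = 0 \<or> y = 0")
  case True
  then show ?thesis
    using ip_zero_right ip_star norm_star by (metis norm_zero mult_zero_left mult_zero_right order_refl)
next
  case False
  define u where "u = complex_of_real (1 / norm x)"
  define v where "v = complex_of_real (1 / norm y)"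
  have "norm (ip (u *\<^sub>C x) (v *\<^sub>C y)) \<le> 4"
    using False by (intro norm_ip_le_unit) (simp_all add: norm_scaleC u_def v_def norm_divide)
  then show ?thesis
    using False
    by (simp add: ip_scaleC_left ip_scaleC_right norm_scaleC u_def v_def norm_divide norm_mult field_simps)
qed

lemma bounded_linear_theta: "bounded_linear (\<lambda>z. y \<cdot> ip x z)"
proof (rule bounded_linear_intro[where K = "norm y * (4 * norm x)"])
  fix z
  have "norm (y \<cdot> ip x z) \<le> norm y * (4 * (norm x * norm z))"
    by (meson norm_act_le norm_ip_le mult_left_mono norm_ge_zero order_trans)
  then show "norm (y \<cdot> ip x z) \<le> norm z * (norm y * (4 * norm x))"
    by (simp add: ac_simps)
qed (simp_all add: ip_add_right act_add_right scaleR_scaleC ip_scaleC_right act_scaleC_right)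

lemma theta_apply: "blinfun_apply (theta y x) z = y \<cdot> ip x z"
  by (simp add: theta_def bounded_linear_Blinfun_apply bounded_linear_theta)

lemma adjoint_op_eqI:
  assumes "\<And>x y. ip (blinfun_apply T x) y = ip x (blinfun_apply S y)"
  shows "adjoint_op T = S"
  unfolding adjoint_op_def
proof (rule the_equality)
  fix R assume R: "\<forall>x y. ip (blinfun_apply T x) y = ip x (blinfun_apply R y)"
  show "R = S"
  proof (rule blinfun_eqI)
    fix y
    have "ip z (blinfun_apply R y - blinfun_apply S y) = 0" for z
      using R assms[of z y] by (simp add: ip_diff_right)
    then show "blinfun_apply R y = blinfun_apply S y"
      using ip_definite by (metis eq_iff_diff_eq_0)
  qed
qed (use assms in simp)

lemma adjoint_op_theta: "adjoint_op (theta y x) = theta x y"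
  by (rule adjoint_op_eqI) (simp add: theta_apply ip_act_left ip_act_right ip_star)

end

end

(*
  Write S N for the partial sums of the frame operator. If xs is a Parseval frame, then
  0 <= <x, S N x> <= <x, x>, which bounds S N and 1 - S N by 1 in norm and gives
  <Dx, Dx> <= <x, Dx> -> 0 for D = 1 - S N. So S N tends to 1 strongly, hence on compact operators,
  and S N has a square root in K(X) as a limit of polynomials in S N without constant term.
  Conversely h = <x, (1 - S N) x> satisfies 0 <= h <= a = <x, x> and h a -> 0, hence
  |h|^2 <= |h a| -> 0.

  The order of the C*-algebra is obtained without spectral theory: an element a is called
  nonnegative if |r - a| <= r in a unitization, square roots come from an iteration, and
  b* b is nonnegative by an argument of Kaplansky.
*)
theory Submission
  imports Defs
begin

section \<open>Square roots in normed algebras\<close>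

text \<open>The inner product supplies positivity only in the form \<open>star b * b\<close>, from
  which neither sums nor norm comparisons are immediate; hence an order has to be built before any
  frame inequality can be used. The condition |r - a| <= r is chosen because, after scaling, it is
  exactly what the square root iteration requires. The iteration is run in three algebras: in A,
  where roots must stay although there may be no unit; in the bounded operators on A, where
  \<open>id_blinfun\<close> provides the unit and elements such as 1 - h^2 have roots; and in the
  bounded operators on X. Bounded operators need not have adjoints, so the iteration uses product
  and norm alone, and self-adjointness of a root comes from closedness of the self-adjoint elements.
  For the converse, writing x as y <y, y> would give S N x -> x from compact operators; the
  inequality |h|^2 <= |h a| replaces this factorization and tests only
  \<open>theta x x\<close>.\<close>

primrec root_scale :: "nat \<Rightarrow> real" where
  "root_scale 0 = 0"
| "root_scale (Suc n) = (1 + (root_scale n)\<^sup>2) / 2"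

lemma root_scale_bounds: "0 \<le> root_scale n \<and> root_scale n \<le> 1"
proof (induction n)
  case (Suc n)
  then have "(root_scale n)\<^sup>2 \<le> 1\<^sup>2" by (intro power_mono) auto
  then show ?case by simp
qed simp

declare root_scale.simps(2) [simp del]

lemma root_scale_nonneg: "0 \<le> root_scale n"
  and root_scale_le_1: "root_scale n \<le> 1"
  using root_scale_bounds by auto

lemma root_scale_Suc_le: "root_scale n \<le> root_scale (Suc n)"
proof -
  have "0 \<le> (1 - root_scale n)\<^sup>2" by simp
  then show ?thesis by (simp add: root_scale.simps(2) power2_eq_square algebra_simps)
qed

lemma root_scale_tendsto_1: "root_scale \<longlonglongrightarrow> 1"
proof -
  have "incseq root_scale" using root_scale_Suc_le by (rule incseq_SucI)
  then obtain l where l: "root_scale \<longlonglongrightarrow> l"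
    using incseq_convergent[of root_scale 1] root_scale_le_1 by blast
  have "(\<lambda>n. root_scale (Suc n)) \<longlonglongrightarrow> (1 + l\<^sup>2) / 2"
    unfolding root_scale.simps by (intro tendsto_intros l) simp
  then have "l = (1 + l\<^sup>2) / 2"
    using LIMSEQ_unique l LIMSEQ_Suc by blast
  then have "(l - 1)\<^sup>2 = 0" by (simp add: power2_eq_square algebra_simps)
  then show ?thesis using l by simp
qed

text \<open>
  An algebra without unit, given by its product. The formal expression \<open>1 - a\<close> only occurs as the
  operator \<open>x \<mapsto> x - a x\<close>, whose operator norm replaces the norm of a unitization.
\<close>

locale normed_product = bounded_bilinear prd
  for prd :: "'b::real_normed_vector \<Rightarrow> 'b \<Rightarrow> 'b" (infixl "\<odot>" 70) +
  assumes assoc: "(a \<odot> b) \<odot> c = a \<odot> (b \<odot> c)"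
    and norm_prd_le: "norm (a \<odot> b) \<le> norm a * norm b"
    and norm_le_of_mult: "0 \<le> k \<Longrightarrow> (\<And>x. norm (a \<odot> x) \<le> k * norm x) \<Longrightarrow> norm a \<le> k"
    and complete: "Cauchy f \<Longrightarrow> convergent (f :: nat \<Rightarrow> 'b)"
begin

text \<open>
  With \<open>y\<^sub>n = t\<^sub>n - d\<^sub>n\<close>, where \<open>t\<^sub>n\<close> is the scalar \<open>root_scale n\<close>, this is the iteration
  \<open>y\<^sub>n\<^sub>+\<^sub>1 = ((1 - s) + y\<^sub>n\<^sup>2) / 2\<close> for the solution \<open>y = 1 - \<surd>s\<close> of \<open>(1 - y)\<^sup>2 = s\<close>. The scalars are
  the same iteration for \<open>s = 0\<close> and dominate it; subtracting them keeps \<open>d\<^sub>n\<close> in the algebra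
  generated by \<open>s\<close>.
\<close>

primrec root_iter :: "'b \<Rightarrow> nat \<Rightarrow> 'b" where
  "root_iter s 0 = 0"
| "root_iter s (Suc n) =
    (1 / 2) *\<^sub>R (s - root_iter s n \<odot> root_iter s n) + root_scale n *\<^sub>R root_iter s n"

declare root_iter.simps(2) [simp del]

definition rt :: "'b \<Rightarrow> 'b" where "rt s = lim (root_iter s)"

context
  fixes s :: 'b
  assumes s: "\<And>x. norm (x - s \<odot> x) \<le> norm x"
begin

text \<open>The element y_n = t_n - d_n of the unitization, seen as a multiplier on the
  algebra.\<close>

definition res :: "nat \<Rightarrow> 'b \<Rightarrow> 'b" where
  "res n x = root_scale n *\<^sub>R x - root_iter s n \<odot> x"

lemma res_diff: "res n (x - y) = res n x - res n y"
  by (simp add: res_def scaleR_diff_right diff_right)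

lemma res_Suc: "res (Suc n) x = (1 / 2) *\<^sub>R ((x - s \<odot> x) + res n (res n x))"
proof -
  let ?t = "root_scale n" and ?d = "root_iter s n"
  have half: "((1 + c) / 2) *\<^sub>R x = (1 / 2) *\<^sub>R x + (1 / 2) *\<^sub>R c *\<^sub>R x" for c
    by (simp add: add_divide_distrib scaleR_add_left)
  have cancel: "(1 / 2) *\<^sub>R z + (1 / 2) *\<^sub>R z = z" for z :: 'b
    by (simp flip: scaleR_add_left)
  have arrange: "a - b + (c - u - (u - v)) = a + c - (b - v + (u + u))" for a b c u v :: 'b
    by simp
  have "res n (res n x) = ?t *\<^sub>R ?t *\<^sub>R x - ?t *\<^sub>R (?d \<odot> x) - (?t *\<^sub>R (?d \<odot> x) - ?d \<odot> (?d \<odot> x))"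
    unfolding res_def diff_right scaleR_right scaleR_diff_right ..
  moreover have "root_iter s (Suc n) \<odot> x
      = (1 / 2) *\<^sub>R (s \<odot> x - ?d \<odot> (?d \<odot> x)) + ?t *\<^sub>R (?d \<odot> x)"
    by (simp only: root_iter.simps add_left scaleR_left diff_left assoc)
  moreover have "(1 / 2) *\<^sub>R (x - p + (?t *\<^sub>R ?t *\<^sub>R x - ?t *\<^sub>R q - (?t *\<^sub>R q - r)))
      = ((1 + ?t\<^sup>2) / 2) *\<^sub>R x - ((1 / 2) *\<^sub>R (p - r) + ?t *\<^sub>R q)" for p q r
    unfolding half power2_eq_square scaleR_scaleR[symmetric]
    by (simp only: scaleR_diff_right scaleR_add_right arrange cancel)
  ultimately show ?thesis by (simp only: res_def root_scale.simps)
qed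

text \<open>Since |1 - s| <= 1, the recursion gives |y_{n+1}| <= (1 + t_n^2) / 2 = t_{n+1}.\<close>

lemma norm_res_le: "norm (res n x) \<le> root_scale n * norm x"
proof (induction n arbitrary: x)
  case (Suc n)
  have "norm (res n (res n x)) \<le> root_scale n * (root_scale n * norm x)"
    by (meson Suc mult_left_mono order_trans root_scale_nonneg)
  then have "norm ((x - s \<odot> x) + res n (res n x)) \<le> norm x + root_scale n * (root_scale n * norm x)"
    using s norm_triangle_mono by blast
  then show ?case
    unfolding res_Suc norm_scaleR by (simp add: root_scale.simps(2) power2_eq_square algebra_simps)
qed (simp add: res_def zero_left)

text \<open>Here y_{n+2} - y_{n+1} = (y_{n+1}^2 - y_n^2) / 2, and the difference of squares is
  y_{n+1} (y_{n+1} - y_n) + (y_{n+1} - y_n) y_n. The scalars satisfy the same identity, so they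
  dominate the steps as well.\<close>

lemma norm_res_step:
  "norm (res (Suc n) x - res n x) \<le> (root_scale (Suc n) - root_scale n) * norm x"
proof (induction n arbitrary: x)
  case 0
  show ?case using s[of x] unfolding res_Suc by (simp add: root_scale.simps(2) res_def zero_left)
next
  case (Suc n)
  let ?t = root_scale
  let ?\<delta> = "?t (Suc n) - ?t n"
  have "res (Suc (Suc n)) x - res (Suc n) x
      = (1 / 2) *\<^sub>R (res (Suc n) (res (Suc n) x) - res n (res n x))"
    unfolding res_Suc[of "Suc n"] res_Suc[of n x]
    by (simp add: scaleR_diff_right scaleR_add_right)
  also have "res (Suc n) (res (Suc n) x) - res n (res n x)
      = res (Suc n) (res (Suc n) x - res n x) + (res (Suc n) (res n x) - res n (res n x))"
    by (simp add: res_diff)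
  finally have eq: "res (Suc (Suc n)) x - res (Suc n) x
      = (1 / 2) *\<^sub>R (res (Suc n) (res (Suc n) x - res n x) + (res (Suc n) (res n x) - res n (res n x)))" .
  have "norm (res (Suc n) (res (Suc n) x - res n x)) \<le> ?t (Suc n) * (?\<delta> * norm x)"
    by (meson norm_res_le Suc mult_left_mono order_trans root_scale_nonneg)
  moreover have "norm (res (Suc n) (res n x) - res n (res n x)) \<le> ?\<delta> * (?t n * norm x)"
    using Suc[of "res n x"] norm_res_le[of n x] root_scale_Suc_le[of n]
    by (meson diff_ge_0_iff_ge mult_left_mono order_trans)
  ultimately have "norm (res (Suc n) (res (Suc n) x - res n x) + (res (Suc n) (res n x) - res n (res n x)))
      \<le> ?t (Suc n) * (?\<delta> * norm x) + ?\<delta> * (?t n * norm x)"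
    by (rule norm_triangle_mono)
  also have "\<dots> = 2 * ((?t (Suc (Suc n)) - ?t (Suc n)) * norm x)"
  proof -
    have eq2: "2 * (?t (Suc (Suc n)) - ?t (Suc n)) = (?t (Suc n) + ?t n) * ?\<delta>"
      by (simp only: root_scale.simps(2)[of "Suc n"] root_scale.simps(2)[of n])
        (simp add: power2_eq_square field_simps)
    show ?thesis
      unfolding mult.assoc[symmetric, of 2] eq2 by (simp add: algebra_simps)
  qed
  finally show ?case unfolding eq by simp
qed

text \<open>As d_n = t_n - y_n, its step is bounded by the step of t_n plus that of y_n; hence the
  factor 2.\<close>

lemma root_iter_step:
  "norm (root_iter s (Suc n) - root_iter s n) \<le> 2 * (root_scale (Suc n) - root_scale n)"
proof (rule norm_le_of_mult)
  let ?\<delta> = "root_scale (Suc n) - root_scale n"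
  show "0 \<le> 2 * ?\<delta>" using root_scale_Suc_le[of n] by simp
  fix x
  have "(root_iter s (Suc n) - root_iter s n) \<odot> x = ?\<delta> *\<^sub>R x - (res (Suc n) x - res n x)"
    by (simp add: res_def diff_left scaleR_diff_left)
  also have "norm \<dots> \<le> norm (?\<delta> *\<^sub>R x) + norm (res (Suc n) x - res n x)"
    by (rule norm_triangle_ineq4)
  also have "\<dots> \<le> ?\<delta> * norm x + ?\<delta> * norm x"
    using norm_res_step[of n x] root_scale_Suc_le[of n] by (simp add: mult.commute)
  finally show "norm ((root_iter s (Suc n) - root_iter s n) \<odot> x) \<le> 2 * ?\<delta> * norm x"
    by (simp only: mult_2 distrib_right)
qed

lemma root_iter_dist:
  "norm (root_iter s (n + k) - root_iter s n) \<le> 2 * (root_scale (n + k) - root_scale n)"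
proof (induction k)
  case (Suc k)
  have chain: "a \<le> 2 * (r - q)" if "a \<le> x + y" "x \<le> 2 * (r - p)" "y \<le> 2 * (p - q)"
    for a x y p q r :: real using that by simp
  have "norm (root_iter s (Suc (n + k)) - root_iter s n)
      \<le> norm (root_iter s (Suc (n + k)) - root_iter s (n + k))
        + norm (root_iter s (n + k) - root_iter s n)"
    by (rule norm_diff_triangle_le[OF order_refl order_refl])
  from chain[OF this root_iter_step Suc] show ?case by simp
qed simp

lemma root_iter_tendsto: "root_iter s \<longlonglongrightarrow> rt s"
proof -
  have "Cauchy (root_iter s)"
  proof (rule metric_CauchyI)
    fix e :: real assume "0 < e"
    \<comment> \<open>The distance to the iterate at M is at most 2 (1 - t_M), which has to be below
      e / 2.\<close>
    then obtain M where M: "\<And>n. n \<ge> M \<Longrightarrow> dist (root_scale n) 1 < e / 4"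
      using metric_LIMSEQ_D[OF root_scale_tendsto_1, of "e / 4"] by auto
    have near: "dist (root_iter s m) (root_iter s M) < e / 2" if "m \<ge> M" for m
    proof -
      obtain k where k: "m = M + k" using le_Suc_ex[OF \<open>m \<ge> M\<close>] by blast
      have "1 - root_scale M < e / 4"
        using M[of M] abs_ge_self[of "1 - root_scale M"] by (simp add: dist_real_def abs_minus_commute)
      then have "2 * (root_scale m - root_scale M) < e / 2"
        using root_scale_le_1[of m] by argo
      then show ?thesis
        using root_iter_dist[of M k] unfolding dist_norm k by (rule order_le_less_trans[rotated])
    qed
    show "\<exists>M. \<forall>m\<ge>M. \<forall>n\<ge>M. dist (root_iter s m) (root_iter s n) < e"
      using dist_triangle_half_l[OF near near] by blast
  qed
  then show ?thesis unfolding rt_def convergent_LIMSEQ_iff[symmetric] by (rule complete)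
qed

text \<open>In the limit t = 1 and the recursion reads d = (s - d^2) / 2 + d, so d = 1 - y is the
  root itself.\<close>

lemma rt_mult_self: "rt s \<odot> rt s = s"
proof -
  have "(\<lambda>n. root_iter s (Suc n)) \<longlonglongrightarrow> (1 / 2) *\<^sub>R (s - rt s \<odot> rt s) + 1 *\<^sub>R rt s"
    unfolding root_iter.simps
    by (intro tendsto_intros tendsto root_iter_tendsto root_scale_tendsto_1)
  then have "rt s = (1 / 2) *\<^sub>R (s - rt s \<odot> rt s) + 1 *\<^sub>R rt s"
    using LIMSEQ_unique LIMSEQ_Suc root_iter_tendsto by blast
  then show ?thesis by simp
qed

lemma norm_minus_rt_le: "norm (x - rt s \<odot> x) \<le> norm x"
proof (rule LIMSEQ_le_const2)
  show "(\<lambda>n. norm (res n x)) \<longlonglongrightarrow> norm (x - rt s \<odot> x)"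
  proof -
    have "(\<lambda>n. norm (res n x)) \<longlonglongrightarrow> norm (1 *\<^sub>R x - rt s \<odot> x)"
      unfolding res_def
      by (intro tendsto_norm tendsto_diff tendsto_scaleR tendsto tendsto_const root_iter_tendsto
          root_scale_tendsto_1)
    then show ?thesis by simp
  qed
  show "\<exists>N. \<forall>n\<ge>N. norm (res n x) \<le> norm x"
    using order_trans[OF norm_res_le mult_left_le_one_le[OF norm_ge_zero root_scale_nonneg root_scale_le_1]]
    by blast
qed

text \<open>The recursion multiplies an iterate only with itself, so closure under squares suffices;
  self-adjoint elements are not closed under general products.\<close>

lemma rt_in_closure:
  assumes "0 \<in> B" "s \<in> B" "\<And>a b. a \<in> B \<Longrightarrow> b \<in> B \<Longrightarrow> a + b \<in> B"
    "\<And>r a. a \<in> B \<Longrightarrow> r *\<^sub>R a \<in> B" "\<And>a. a \<in> B \<Longrightarrow> a \<odot> a \<in> B"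
  shows "rt s \<in> closure B"
proof -
  have "root_iter s n \<in> B" for n
  proof (induction n)
    case (Suc n)
    have "root_iter s (Suc n) = (1 / 2) *\<^sub>R (s + (-1) *\<^sub>R (root_iter s n \<odot> root_iter s n))
        + root_scale n *\<^sub>R root_iter s n" by (simp add: root_iter.simps(2))
    then show ?case using Suc by (simp only: assms)
  qed (use assms in simp)
  then show ?thesis
    unfolding closure_sequential using root_iter_tendsto by (intro exI[of _ "root_iter s"]) simp
qed

end

text \<open>The case s = s' yields commutation with the root; two different elements occur in the
  argument for \<open>star b * b\<close>.\<close>

lemma rt_intertwines:
  assumes "\<And>x. norm (x - s \<odot> x) \<le> norm x" "\<And>x. norm (x - s' \<odot> x) \<le> norm x"
    and "s \<odot> w = w \<odot> s'"
  shows "rt s \<odot> w = w \<odot> rt s'"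
proof -
  have "root_iter s n \<odot> w = w \<odot> root_iter s' n" for n
  proof (induction n)
    case (Suc n)
    have "(root_iter s n \<odot> root_iter s n) \<odot> w = w \<odot> (root_iter s' n \<odot> root_iter s' n)"
      by (simp only: assoc Suc) (simp only: assoc[symmetric] Suc)
    then show ?case
      using Suc assms(3)
      by (simp add: root_iter.simps(2) add_left add_right scaleR_left scaleR_right diff_left diff_right)
  qed (simp add: zero_left zero_right)
  moreover have "(\<lambda>n. root_iter s n \<odot> w) \<longlonglongrightarrow> rt s \<odot> w"
    by (intro tendsto tendsto_const root_iter_tendsto assms)
  moreover have "(\<lambda>n. w \<odot> root_iter s' n) \<longlonglongrightarrow> w \<odot> rt s'"
    by (intro tendsto tendsto_const root_iter_tendsto assms)
  ultimately show ?thesis by (simp add: LIMSEQ_unique)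
qed

end

section \<open>The Banach algebra of bounded operators\<close>

lemma Cauchy_blinfun_convergent:
  fixes F :: "nat \<Rightarrow> 'b::real_normed_vector \<Rightarrow>\<^sub>L 'c::{real_normed_vector, complete_space}"
  assumes "Cauchy F"
  shows "convergent F"
proof -
  have near: "\<exists>M. \<forall>m\<ge>M. \<forall>n\<ge>M. norm (F m - F n) < e" if "0 < e" for e
    using CauchyD[OF assms that] .
  have bound: "norm (F m x - F n x) \<le> norm (F m - F n) * norm x" for m n x
    using norm_blinfun[of "F m - F n" x] by (simp add: blinfun.diff_left)
  have "Cauchy (\<lambda>n. F n x)" for x
    by (rule bounded_linear.Cauchy[OF blinfun.bounded_linear_left assms])
  then have "\<exists>l. (\<lambda>n. F n x) \<longlonglongrightarrow> l" for x
    using Cauchy_convergent convergent_def by blast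
  then obtain V where V: "\<And>x. (\<lambda>n. F n x) \<longlonglongrightarrow> V x" by metis
  obtain K where K: "\<And>n. norm (F n) \<le> K"
    using cauchy_imp_bounded[OF assms] unfolding bounded_iff by blast
  have lin: "bounded_linear V"
  proof (rule bounded_linear_intro[where K = K])
    fix x y :: 'b and r :: real
    have "(\<lambda>n. F n (x + y)) \<longlonglongrightarrow> V x + V y"
      unfolding blinfun.add_right by (intro tendsto_add V)
    then show "V (x + y) = V x + V y" using V LIMSEQ_unique by blast
    have "(\<lambda>n. F n (r *\<^sub>R x)) \<longlonglongrightarrow> r *\<^sub>R V x"
      unfolding blinfun.scaleR_right by (intro tendsto_intros V)
    then show "V (r *\<^sub>R x) = r *\<^sub>R V x" using V LIMSEQ_unique by blast
    have "norm (F n x) \<le> norm x * K" for n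
      using norm_blinfun[of "F n" x] mult_right_mono[OF K[of n] norm_ge_zero[of x]]
      by (simp add: mult.commute)
    then show "norm (V x) \<le> norm x * K"
      using LIMSEQ_le_const2[OF tendsto_norm[OF V[of x]]] by blast
  qed
  have "F \<longlonglongrightarrow> Blinfun V"
  proof (rule LIMSEQ_I)
    fix e :: real assume "0 < e"
    then obtain M where M: "\<And>m n. m \<ge> M \<Longrightarrow> n \<ge> M \<Longrightarrow> norm (F m - F n) < e / 2"
      using near[of "e / 2"] by auto
    have "norm (F m - Blinfun V) \<le> e / 2" if "m \<ge> M" for m
    proof (rule norm_blinfun_bound)
      fix x
      have "norm (F m x - F n x) \<le> e / 2 * norm x" if "n \<ge> M" for n
        using bound[of m x n] M[OF \<open>m \<ge> M\<close> that] mult_right_mono[of "norm (F m - F n)" "e/2" "norm x"]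
        by simp
      then have "norm (F m x - V x) \<le> e / 2 * norm x"
        using LIMSEQ_le_const2[OF tendsto_norm[OF tendsto_diff[OF tendsto_const V[of x]]]] by blast
      then show "norm (blinfun_apply (F m - Blinfun V) x) \<le> e / 2 * norm x"
        by (simp add: blinfun.diff_left bounded_linear_Blinfun_apply[OF lin])
    qed (use \<open>0 < e\<close> in simp)
    then show "\<exists>no. \<forall>n\<ge>no. norm (F n - Blinfun V) < e"
      using \<open>0 < e\<close> by (intro exI[of _ M] allI impI) (force intro: order_le_less_trans)
  qed
  then show ?thesis unfolding convergent_def by blast
qed

lemma normed_product_blinfun_compose:
  "normed_product ((o\<^sub>L) :: ('c::{real_normed_vector, complete_space} \<Rightarrow>\<^sub>L 'c) \<Rightarrow> _)"
proof -
  interpret bounded_bilinear "(o\<^sub>L) :: ('c \<Rightarrow>\<^sub>L 'c) \<Rightarrow> ('c \<Rightarrow>\<^sub>L 'c) \<Rightarrow> 'c \<Rightarrow>\<^sub>L 'c"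
    by (rule bounded_bilinear_blinfun_compose)
  show ?thesis
  proof
    fix a b c :: "'c \<Rightarrow>\<^sub>L 'c" and k :: real and f :: "nat \<Rightarrow> 'c \<Rightarrow>\<^sub>L 'c"
    show "(a o\<^sub>L b) o\<^sub>L c = a o\<^sub>L (b o\<^sub>L c)" by (simp add: blinfun_eqI)
    show "norm (a o\<^sub>L b) \<le> norm a * norm b" by (rule norm_blinfun_compose)
    show "Cauchy f \<Longrightarrow> convergent f" by (rule Cauchy_blinfun_convergent)
    assume "0 \<le> k" and le: "\<And>x::'c \<Rightarrow>\<^sub>L 'c. norm (a o\<^sub>L x) \<le> k * norm x"
    have "norm a \<le> k * norm (id_blinfun :: 'c \<Rightarrow>\<^sub>L 'c)"
      using le[of id_blinfun] by (simp add: blinfun_eqI[of "a o\<^sub>L id_blinfun" a])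
    \<comment> \<open>Only an inequality, since \<open>id_blinfun\<close> has norm 0 on the zero
      space.\<close>
    also have "\<dots> \<le> k * 1"
      using \<open>0 \<le> k\<close> norm_blinfun_id_le by (intro mult_left_mono)
    finally show "norm a \<le> k" by simp
  qed
qed

global_interpretation op: normed_product
  "(o\<^sub>L) :: ('c::{real_normed_vector, complete_space} \<Rightarrow>\<^sub>L 'c) \<Rightarrow> _"
  defines op_rt = op.rt and op_root_iter = op.root_iter
  by (rule normed_product_blinfun_compose)

section \<open>Self-adjoint operators and positive elements\<close>

context hilbert_module
begin

text \<open>Stated by the form and not by \<open>adjoint_op\<close>: no existence of an adjoint has
  to be settled, and the condition is visibly closed.\<close>

definition selfadj :: "('x \<Rightarrow>\<^sub>L 'x) \<Rightarrow> bool"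
  where "selfadj T \<longleftrightarrow> (\<forall>x y. ip (T x) y = ip x (T y))"

lemma ip_scaleR_right: "ip x (r *\<^sub>R y) = r *\<^sub>R ip x y"
  by (simp add: scaleR_scaleC ip_scaleC_right)

lemma ip_scaleR_left: "ip (r *\<^sub>R x) y = r *\<^sub>R ip x y"
  by (simp add: scaleR_scaleC ip_scaleC_left)

lemma bounded_bilinear_ip: "bounded_bilinear ip"
proof
  show "\<exists>K. \<forall>a b. norm (ip a b) \<le> norm a * norm b * K"
    using norm_ip_le by (intro exI[of _ 4]) (simp add: mult.commute)
qed (simp_all add: ip_add_left ip_add_right ip_scaleR_left ip_scaleR_right)

lemma selfadj_id: "selfadj id_blinfun"
  by (simp add: selfadj_def)

lemma selfadj_add: "selfadj S \<Longrightarrow> selfadj T \<Longrightarrow> selfadj (S + T)"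
  by (simp add: selfadj_def blinfun.add_left ip_add_left ip_add_right)

lemma selfadj_scaleR: "selfadj T \<Longrightarrow> selfadj (r *\<^sub>R T)"
  by (simp add: selfadj_def blinfun.scaleR_left ip_scaleR_left ip_scaleR_right)

lemma selfadj_diff: "selfadj S \<Longrightarrow> selfadj T \<Longrightarrow> selfadj (S - T)"
  using selfadj_add[of S "(-1) *\<^sub>R T"] selfadj_scaleR[of T "-1"] by simp

lemma selfadj_compose_self: "selfadj T \<Longrightarrow> selfadj (T o\<^sub>L T)"
  by (simp add: selfadj_def)

lemma selfadj_adjoint_op: "selfadj T \<Longrightarrow> adjoint_op T = T"
  by (rule adjoint_op_eqI) (simp add: selfadj_def)

lemma closed_selfadj: "closed {T. selfadj T}"
proof -
  have "closed {T. ip (blinfun_apply T x) y = ip x (blinfun_apply T y)}" for x y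
    by (intro closed_Collect_eq bounded_bilinear.continuous_on[OF bounded_bilinear_ip]
        continuous_on_const blinfun.continuous_on continuous_on_id)
  then show ?thesis
    unfolding selfadj_def by (intro closed_Collect_all)
qed

end

text \<open>For operators the unit is present, so the hypothesis of the iteration is a plain norm
  bound on 1 - S.\<close>

lemma op_rt_bound:
  assumes "norm (id_blinfun - S) \<le> 1"
  shows "norm (T - (S o\<^sub>L T)) \<le> norm T"
proof -
  have "T - (S o\<^sub>L T) = (id_blinfun - S) o\<^sub>L T"
    by (rule blinfun_eqI) (simp add: blinfun.diff_left)
  then show ?thesis
    using order_trans[OF norm_blinfun_compose mult_left_le_one_le[OF norm_ge_zero norm_ge_zero assms]]
    by simp
qed

lemma (in hilbert_module) selfadj_op_rt:
  assumes "norm (id_blinfun - S) \<le> 1" "selfadj S"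
  shows "selfadj (op_rt S)"
proof -
  have "selfadj 0" using selfadj_scaleR[OF selfadj_id, of 0] by simp
  then have "op_rt S \<in> closure {T. selfadj T}"
    using assms
    by (intro op.rt_in_closure op_rt_bound)
      (simp_all add: selfadj_add selfadj_scaleR selfadj_compose_self)
  then show ?thesis using closed_selfadj by simp
qed

text \<open>The algebra as a module over itself. Operators on it serve as a unitization: left
  multiplications embed the algebra and \<open>id_blinfun\<close> is the unit.\<close>

global_interpretation self: hilbert_module "(*)" "\<lambda>a b :: 'a::cstar_algebra. star a * b"
proof
  show "positive_in UNIV (*) star (star x * x)" for x :: 'a
    unfolding positive_in_def by blast
  show "x = 0" if "star x * x = 0" for x :: 'a
    using that cstar_identity[of x] by simp
qed (simp_all add: distrib_left distrib_right mult.assoc mult_scaleC_left mult_scaleC_right star_mult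
    star_star cstar_identity)

lemma norm_mult_star: "norm (a * star a) = (norm (a::'a::cstar_algebra))\<^sup>2"
  using cstar_identity[of "star a"] by (simp add: star_star self.norm_star)

lemma normed_product_times: "normed_product ((*) :: 'a::cstar_algebra \<Rightarrow> _)"
proof -
  interpret bounded_bilinear "(*) :: 'a \<Rightarrow> 'a \<Rightarrow> 'a" by (rule bounded_bilinear_mult)
  show ?thesis
  proof
    fix a :: 'a and k :: real
    assume "0 \<le> k" and "\<And>x. norm (a * x) \<le> k * norm x"
    \<comment> \<open>The test element \<open>star a\<close> stands in for a unit, by the
      C*-identity.\<close>
    then have "norm (a * star a) \<le> k * norm (star a)" by blast
    then have "norm a * norm a \<le> k * norm a"
      by (simp only: norm_mult_star power2_eq_square self.norm_star)
    then show "norm a \<le> k" using \<open>0 \<le> k\<close> by (cases "norm a = 0") auto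
  qed (auto simp: mult.assoc norm_mult_ineq Cauchy_convergent)
qed

global_interpretation mul: normed_product "(*) :: 'a::cstar_algebra \<Rightarrow> _"
  defines alg_rt = mul.rt and alg_root_iter = mul.root_iter
  by (rule normed_product_times)

lemma star_scaleR: "star (r *\<^sub>R a) = r *\<^sub>R star (a::'a::cstar_algebra)"
  by (simp add: scaleR_scaleC star_scaleC)

lemma star_zero: "star 0 = (0::'a::cstar_algebra)"
  using star_add[of "0::'a" 0] by simp

lemma star_diff: "star (a - b) = star a - star (b::'a::cstar_algebra)"
  using star_add[of "a - b" b] by simp

lemma selfadj_square_eq_0: "star a = a \<Longrightarrow> a * a = 0 \<Longrightarrow> a = (0::'a::cstar_algebra)"
  using cstar_identity[of a] by simp

lemma star_tendsto:
  fixes f :: "nat \<Rightarrow> 'a::cstar_algebra"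
  assumes "f \<longlonglongrightarrow> l"
  shows "(\<lambda>n. star (f n)) \<longlonglongrightarrow> star l"
proof -
  have "bounded_linear (star :: 'a \<Rightarrow> 'a)"
    by (rule bounded_linear_intro[where K = 1]) (simp_all add: star_add star_scaleR self.norm_star)
  then show ?thesis using assms by (rule bounded_linear.tendsto)
qed

text \<open>The C*-identity for \<open>c + i h\<close>, which has adjoint \<open>c - i h\<close>.\<close>

lemma norm_apply_le_sum_squares:
  fixes c h :: "'a::cstar_algebra \<Rightarrow>\<^sub>L 'a"
  assumes c: "self.selfadj c" and h: "self.selfadj h" and comm: "c o\<^sub>L h = h o\<^sub>L c"
    and k: "norm ((c o\<^sub>L c) + (h o\<^sub>L h)) \<le> k"
  shows "(norm (c x))\<^sup>2 \<le> k * (norm x)\<^sup>2"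
proof -
  have comm': "c (h x) = h (c x)"
    using arg_cong[OF comm, of "\<lambda>T. blinfun_apply T x"] by simp
  have sc: "star (c y) * z = star y * c z" and sh: "star (h y) * z = star y * h z" for y z
    using c h by (auto simp: self.selfadj_def)
  \<comment> \<open>For this scalar the cross terms add up to a multiple of <x, (c h - h c) x> = 0,
    which leaves <x, (c^2 + h^2) x>.\<close>
  have bound: "(norm (c x + \<epsilon> *\<^sub>C h x))\<^sup>2 \<le> k * (norm x)\<^sup>2" if \<epsilon>: "\<epsilon> = \<i> \<or> \<epsilon> = - \<i>" for \<epsilon>
  proof -
    have "cnj \<epsilon> = - \<epsilon>" "\<epsilon> * \<epsilon> = - 1" using \<epsilon> by auto
    then have "star (c x + \<epsilon> *\<^sub>C h x) * (c x + \<epsilon> *\<^sub>C h x)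
        = star x * c (c x) + \<epsilon> *\<^sub>C (star x * c (h x)) - \<epsilon> *\<^sub>C (star x * h (c x)) + star x * h (h x)"
      by (simp add: star_add star_scaleC distrib_left distrib_right mult_scaleC_left mult_scaleC_right
          sc sh scaleC_scaleC scaleC_one complex_vector.scale_minus_left left_diff_distrib
          complex_vector.scale_right_diff_distrib)
    also have "\<dots> = star x * ((c o\<^sub>L c) + (h o\<^sub>L h)) x"
      by (simp add: comm' blinfun.add_left distrib_left)
    finally have "(norm (c x + \<epsilon> *\<^sub>C h x))\<^sup>2 = norm (star x * ((c o\<^sub>L c) + (h o\<^sub>L h)) x)"
      by (simp only: cstar_identity[symmetric])
    also have "\<dots> \<le> norm x * norm (((c o\<^sub>L c) + (h o\<^sub>L h)) x)"
      using norm_mult_ineq[of "star x"] by (simp only: self.norm_star)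
    also have "\<dots> \<le> norm x * (norm ((c o\<^sub>L c) + (h o\<^sub>L h)) * norm x)"
      by (intro mult_left_mono norm_blinfun norm_ge_zero)
    also have "\<dots> \<le> norm x * (k * norm x)"
      using k by (intro mult_left_mono mult_right_mono norm_ge_zero)
    finally show ?thesis by (simp add: power2_eq_square ac_simps)
  qed
  have "2 *\<^sub>R c x = (c x + \<i> *\<^sub>C h x) + (c x + (- \<i>) *\<^sub>C h x)"
    by (simp add: complex_vector.scale_minus_left scaleR_2)
  then have "norm (2 *\<^sub>R c x) \<le> norm (c x + \<i> *\<^sub>C h x) + norm (c x + (- \<i>) *\<^sub>C h x)"
    by (simp only: norm_triangle_ineq)
  moreover have "norm (c x + \<i> *\<^sub>C h x) \<le> sqrt (k * (norm x)\<^sup>2)"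
    "norm (c x + (- \<i>) *\<^sub>C h x) \<le> sqrt (k * (norm x)\<^sup>2)"
    by (intro real_le_rsqrt bound; simp)+
  ultimately have "norm (c x) \<le> sqrt (k * (norm x)\<^sup>2)" by simp
  then have "(norm (c x))\<^sup>2 \<le> (sqrt (k * (norm x)\<^sup>2))\<^sup>2" by (rule power_mono) simp
  moreover have "0 \<le> k" using norm_ge_zero k by (rule order_trans)
  ultimately show ?thesis by simp
qed

text \<open>For r >= 0 this says in spectral terms that a is self-adjoint with spectrum in
  [0, 2 r].\<close>

definition nonneg_within :: "real \<Rightarrow> 'a::cstar_algebra \<Rightarrow> bool"
  where "nonneg_within r a \<longleftrightarrow> star a = a \<and> (\<forall>x. norm (r *\<^sub>R x - a * x) \<le> r * norm x)"

text \<open>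
  Positivity through the norm of \<open>r - a\<close> in a unitization: positive elements then form a convex
  cone at once, while positivity of \<open>star b * b\<close> becomes the hard part.
\<close>

definition nonneg :: "'a::cstar_algebra \<Rightarrow> bool"
  where "nonneg a \<longleftrightarrow> (\<exists>r>0. nonneg_within r a)"

text \<open>The iteration accepts elements within distance 1 of the unit, so a is divided by r first
  and the root rescaled.\<close>

definition psqrt :: "real \<Rightarrow> 'a::cstar_algebra \<Rightarrow> 'a"
  where "psqrt r a = sqrt r *\<^sub>R alg_rt ((1 / r) *\<^sub>R a)"

section \<open>The cone of nonnegative elements and their roots\<close>

lemma nonneg_within_star: "nonneg_within r a \<Longrightarrow> star a = a"
  by (simp add: nonneg_within_def)

lemma nonneg_star: "nonneg a \<Longrightarrow> star a = a"
  by (auto simp: nonneg_def nonneg_within_def)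

lemma nonneg_within_add:
  assumes "nonneg_within r a" "nonneg_within s b"
  shows "nonneg_within (r + s) (a + b)"
proof -
  have "norm ((r + s) *\<^sub>R x - (a + b) * x) \<le> (r + s) * norm x" for x
  proof -
    have "norm ((r *\<^sub>R x - a * x) + (s *\<^sub>R x - b * x)) \<le> r * norm x + s * norm x"
      using assms by (intro norm_triangle_mono) (auto simp: nonneg_within_def)
    then show ?thesis by (simp add: algebra_simps)
  qed
  then show ?thesis using assms by (simp add: nonneg_within_def star_add)
qed

lemma nonneg_within_zero: "0 \<le> r \<Longrightarrow> nonneg_within r 0"
  by (simp add: nonneg_within_def star_zero)

lemma nonneg_within_mono: "nonneg_within r a \<Longrightarrow> r \<le> s \<Longrightarrow> nonneg_within s a"
  using nonneg_within_add[of r a "s - r" 0] by (simp add: nonneg_within_zero)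

lemma nonneg_within_scaleR:
  assumes "nonneg_within r a" "0 \<le> s"
  shows "nonneg_within (s * r) (s *\<^sub>R a)"
proof -
  have "norm ((s * r) *\<^sub>R x - (s *\<^sub>R a) * x) \<le> s * r * norm x" for x
  proof -
    have "(s * r) *\<^sub>R x - (s *\<^sub>R a) * x = s *\<^sub>R (r *\<^sub>R x - a * x)"
      by (simp add: scaleR_diff_right)
    then have "norm ((s * r) *\<^sub>R x - (s *\<^sub>R a) * x) = s * norm (r *\<^sub>R x - a * x)"
      using assms by simp
    also have "\<dots> \<le> s * (r * norm x)"
      using assms by (intro mult_left_mono) (auto simp: nonneg_within_def)
    finally show ?thesis by (simp add: mult.assoc)
  qed
  then show ?thesis using assms by (simp add: nonneg_within_def star_scaleR)
qed

lemma nonneg_zero: "nonneg 0"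
  unfolding nonneg_def using nonneg_within_zero[of 1] by (intro exI[of _ 1]) simp

lemma nonneg_add: "nonneg a \<Longrightarrow> nonneg b \<Longrightarrow> nonneg (a + b)"
  unfolding nonneg_def by (blast intro: nonneg_within_add add_pos_pos)

lemma nonneg_scaleR: "nonneg a \<Longrightarrow> 0 \<le> s \<Longrightarrow> nonneg (s *\<^sub>R a)"
proof (cases "s = 0")
  case False
  assume "nonneg a" "0 \<le> s"
  then obtain r where "0 < r" "nonneg_within r a" by (auto simp: nonneg_def)
  with False \<open>0 \<le> s\<close> show ?thesis
    unfolding nonneg_def by (intro exI[of _ "s * r"]) (simp add: nonneg_within_scaleR)
qed (simp add: nonneg_zero)

lemma nonneg_sum: "(\<And>i. i \<in> I \<Longrightarrow> nonneg (f i)) \<Longrightarrow> nonneg (sum f I)"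
  by (induction I rule: infinite_finite_induct) (auto simp: nonneg_zero nonneg_add)

lemma psqrt_bound:
  assumes "nonneg_within r a" "0 < r"
  shows "norm (x - ((1 / r) *\<^sub>R a) * x) \<le> norm x"
  using nonneg_within_scaleR[OF assms(1), of "1 / r"] assms by (simp add: nonneg_within_def)

lemma psqrt_mult_self:
  assumes "nonneg_within r a" "0 < r"
  shows "psqrt r a * psqrt r a = a"
  using mul.rt_mult_self[OF psqrt_bound[OF assms]] assms by (simp add: psqrt_def)

lemma psqrt_nonneg:
  assumes "nonneg_within r a" "0 < r"
  shows "nonneg (psqrt r a)"
proof -
  let ?b = "alg_rt ((1 / r) *\<^sub>R a)"
  have "?b \<in> closure {d. star d = d}"
    using assms
    by (intro mul.rt_in_closure psqrt_bound[OF assms])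
      (auto simp: star_zero star_add star_scaleR star_mult nonneg_within_star)
  moreover have "closed {d::'a. star d = d}"
    unfolding closed_sequential_limits
  proof (intro allI impI, elim conjE)
    fix f and l :: 'a
    assume "\<forall>n. f n \<in> {d. star d = d}" and f: "f \<longlonglongrightarrow> l"
    then have "f \<longlonglongrightarrow> star l" using star_tendsto[OF f] by simp
    then show "l \<in> {d. star d = d}" using LIMSEQ_unique f by blast
  qed
  ultimately have "star ?b = ?b" by simp
  then have "nonneg_within 1 ?b"
    using mul.norm_minus_rt_le[OF psqrt_bound[OF assms]] by (simp add: nonneg_within_def)
  then have "nonneg ?b" unfolding nonneg_def by (intro exI[of _ 1]) simp
  then show ?thesis unfolding psqrt_def using assms by (simp add: nonneg_scaleR)
qed

lemma psqrt_intertwines: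
  assumes "nonneg_within r a" "nonneg_within r b" "0 < r" "a * w = w * b"
  shows "psqrt r a * w = w * psqrt r b"
proof -
  have "((1 / r) *\<^sub>R a) * w = w * ((1 / r) *\<^sub>R b)" using assms by simp
  then show ?thesis
    using mul.rt_intertwines[OF psqrt_bound[OF assms(1,3)] psqrt_bound[OF assms(2,3)], of w]
    by (simp add: psqrt_def)
qed

text \<open>The clause on w replaces functional calculus: the root commutes with whatever commutes
  with a.\<close>

lemma nonneg_sqrt:
  assumes "nonneg a"
  obtains e where "nonneg e" "e * e = a" "\<And>w. a * w = w * a \<Longrightarrow> e * w = w * e"
proof -
  obtain r where r: "0 < r" "nonneg_within r a" using assms by (auto simp: nonneg_def)
  show thesis
    by (rule that[of "psqrt r a"]) (intro psqrt_nonneg psqrt_mult_self psqrt_intertwines r; simp)+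
qed

text \<open>Left multiplication; the word "right" in the constant refers to the factor that
  varies.\<close>

abbreviation lmult :: "'a::cstar_algebra \<Rightarrow> 'a \<Rightarrow>\<^sub>L 'a" where "lmult \<equiv> blinfun_mult_right"

lemma norm_lmult_le: "norm (lmult a) \<le> norm a"
  by (rule norm_blinfun_bound) (simp_all add: norm_mult_ineq)

lemma selfadj_lmult: "star a = a \<Longrightarrow> self.selfadj (lmult a)"
  by (simp add: self.selfadj_def star_mult mult.assoc)

text \<open>For \<open>c = \<surd>(1 - h\<^sup>2)\<close> the operator \<open>c + i h\<close> is unitary, so \<open>c\<close> is a contraction.\<close>

lemma square_nonneg_within:
  assumes h: "star h = h" and r: "0 < r" "(norm h)\<^sup>2 \<le> r"
  shows "nonneg_within r (h * h)"
proof -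
  define H where "H = (1 / sqrt r) *\<^sub>R lmult h"
  \<comment> \<open>H is scaled to a contraction, so 1 - S = H^2 meets the hypothesis of the
    iteration and S, that is 1 - h^2 / r, has a root among the operators.\<close>
  define S where "S = id_blinfun - (H o\<^sub>L H)"
  define c where "c = op_rt S"
  have HH: "(H o\<^sub>L H) x = (1 / r) *\<^sub>R (h * h * x)" for x
    using r by (simp add: H_def blinfun.scaleR_left mult.assoc)
  have "norm h \<le> sqrt r" by (rule real_le_rsqrt) (rule r)
  then have "norm H \<le> 1"
    using norm_lmult_le[of h] r by (simp add: H_def)
  then have "norm (H o\<^sub>L H) \<le> 1"
    by (intro order_trans[OF norm_blinfun_compose] mult_le_one norm_ge_zero)
  then have S: "norm (id_blinfun - S) \<le> 1" by (simp add: S_def diff_diff_eq2)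
  have H: "self.selfadj H" unfolding H_def by (intro self.selfadj_scaleR selfadj_lmult h)
  have "self.selfadj S"
    unfolding S_def by (intro self.selfadj_diff self.selfadj_id self.selfadj_compose_self H)
  then have "self.selfadj c" unfolding c_def by (intro self.selfadj_op_rt S)
  moreover have "S o\<^sub>L H = H o\<^sub>L S"
    by (rule blinfun_eqI) (simp add: S_def blinfun.diff_left blinfun.diff_right)
  then have "c o\<^sub>L H = H o\<^sub>L c"
    unfolding c_def by (intro op.rt_intertwines op_rt_bound S)
  moreover have cc: "c o\<^sub>L c = S"
    unfolding c_def by (intro op.rt_mult_self op_rt_bound S)
  then have "norm ((c o\<^sub>L c) + (H o\<^sub>L H)) \<le> 1"
    by (simp add: S_def norm_blinfun_id_le)
  ultimately have "(norm (c x))\<^sup>2 \<le> 1 * (norm x)\<^sup>2" for x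
    using H by (intro norm_apply_le_sum_squares)
  then have c: "norm (c x) \<le> norm x" for x
    using power2_le_imp_le[OF _ norm_ge_zero[of x], of "norm (c x)"] by (simp only: mult_1)
  have "norm (r *\<^sub>R x - h * h * x) \<le> r * norm x" for x
  proof -
    have "c (c x) = x - (1 / r) *\<^sub>R (h * h * x)"
      using arg_cong[OF cc, of "\<lambda>T. blinfun_apply T x"] HH by (simp add: S_def blinfun.diff_left)
    then have "r *\<^sub>R x - h * h * x = r *\<^sub>R c (c x)"
      using r by (simp add: scaleR_diff_right)
    moreover have "norm (c (c x)) \<le> norm x" using c order_trans by blast
    ultimately show ?thesis using r by simp
  qed
  then show ?thesis using h by (simp add: nonneg_within_def star_mult)
qed

lemma square_nonneg: "star h = h \<Longrightarrow> nonneg (h * h)"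
  unfolding nonneg_def
  \<comment> \<open>Adding 1 keeps the radius positive when h = 0.\<close>
  by (intro exI[of _ "(norm h)\<^sup>2 + 1"] conjI square_nonneg_within) (auto intro: add_nonneg_pos)

text \<open>For commuting roots e of a and f of -a, \<open>star (e + i f) * (e + i f)\<close> equals
  e^2 + f^2 = 0. Thus e + i f vanishes together with its adjoint e - i f, and so does e.\<close>

lemma nonneg_antisym:
  assumes a: "nonneg a" and ma: "nonneg (- a)"
  shows "a = 0"
proof -
  obtain e where e: "nonneg e" "e * e = a" using nonneg_sqrt[OF a] .
  obtain f where f: "nonneg f" "f * f = - a" "\<And>w. - a * w = w * - a \<Longrightarrow> f * w = w * f"
    by (rule nonneg_sqrt[OF ma]) blast
  have fe: "f * e = e * f" using f(3)[of e] by (simp add: e(2)[symmetric] mult.assoc)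
  have "star (e + \<i> *\<^sub>C f) * (e + \<i> *\<^sub>C f) = 0"
    using e f(1,2)
    by (simp add: star_add star_scaleC nonneg_star distrib_left distrib_right mult_scaleC_left
        mult_scaleC_right fe scaleC_scaleC scaleC_one complex_vector.scale_minus_left left_diff_distrib
        complex_vector.scale_right_diff_distrib scaleC_add_right)
  then have 0: "e + \<i> *\<^sub>C f = 0" using self.ip_definite by blast
  have "star (\<i> *\<^sub>C f) = - (\<i> *\<^sub>C f)"
    using f(1) by (simp add: star_scaleC nonneg_star complex_vector.scale_minus_left)
  then have "e - \<i> *\<^sub>C f = star (e + \<i> *\<^sub>C f)"
    using e by (simp only: star_add nonneg_star diff_conv_add_uminus)
  then have "e = \<i> *\<^sub>C f" by (simp add: 0 star_zero)
  then have "e + e = 0" using 0 by simp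
  then have "2 *\<^sub>R e = 0" by (simp add: scaleR_2)
  then show ?thesis using e by simp
qed

text \<open>Uniqueness of the nonnegative root. For d = n - m the elements n d^2 and m d^2 are both
  nonnegative, and their sum is (n^2 - m^2) d = 0; so both vanish by antisymmetry, d^3 = 0 follows,
  and d = 0 as d is self-adjoint.\<close>

lemma psqrt_square:
  assumes m: "nonneg m" and r: "nonneg_within r (m * m)" "0 < r"
  shows "psqrt r (m * m) = m"
proof -
  define n where "n = psqrt r (m * m)"
  define d where "d = n - m"
  have nn: "n * n = m * m" and n: "nonneg n"
    unfolding n_def using psqrt_mult_self psqrt_nonneg r by auto
  have nm: "n * m = m * n"
    unfolding n_def by (rule psqrt_intertwines[OF r(1) r(1) r(2)]) (simp add: mult.assoc)
  have d: "star d = d" using m n by (simp add: d_def star_diff nonneg_star)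
  \<comment> \<open>The root g of k commutes with d, so k d^2 = (g d)^2 is the square of a
    self-adjoint element.\<close>
  have square: "nonneg (k * (d * d))" if k: "nonneg k" and kd: "k * d = d * k" for k
  proof -
    obtain g where g: "nonneg g" "g * g = k" "g * d = d * g" by (rule nonneg_sqrt[OF k]) (use kd in blast)
    then have "nonneg ((g * d) * (g * d))"
      using d by (intro square_nonneg) (simp add: star_mult nonneg_star)
    also have "(g * d) * (g * d) = k * (d * d)" using g by (metis mult.assoc)
    finally show ?thesis .
  qed
  have "n * (d * d) + m * (d * d) = 0"
  proof -
    have "(n + m) * d = 0" by (simp add: d_def algebra_simps nn nm)
    then show ?thesis by (metis distrib_right mult.assoc mult_zero_left)
  qed
  then have opp: "m * (d * d) = - (n * (d * d))" by (simp add: eq_neg_iff_add_eq_0 add.commute)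
  have "nonneg (n * (d * d))" "nonneg (m * (d * d))"
    using m n by (intro square; simp add: d_def algebra_simps nm)+
  then have "n * (d * d) = 0" using opp nonneg_antisym by metis
  then have "d * (d * d) = 0" using opp by (simp add: d_def left_diff_distrib)
  then have "(d * d) * (d * d) = 0" by (metis mult.assoc mult_zero_right)
  then have "d * d = 0" using d by (intro selfadj_square_eq_0[of "d * d"]) (simp_all add: star_mult)
  then have "d = 0" using d selfadj_square_eq_0[of d] by simp
  then show ?thesis by (simp add: d_def n_def)
qed

text \<open>
  If \<open>star w * w = - k\<close> with \<open>k \<ge> 0\<close>, then \<open>m = w * star w\<close> is positive because \<open>m - k\<close> is a sum of
  squares, and \<open>m\<^sup>2 w = w k\<^sup>2\<close> gives \<open>m w = w k\<close> by taking square roots, whereas \<open>m w = - w k\<close>.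
\<close>

lemma star_mult_nonpos_eq_0:
  assumes k: "nonneg k" and w: "star w * w = - k"
  shows "k = 0"
proof -
  define m where "m = w * star w"
  define u where "u = w + star w"
  define v where "v = \<i> *\<^sub>C (w - star w)"
  have "star u = u" "star v = v"
    by (simp_all add: u_def v_def star_add star_diff star_scaleC star_star
        complex_vector.scale_minus_left complex_vector.scale_right_diff_distrib)
  then have "nonneg ((1 / 2) *\<^sub>R (u * u + v * v) + k)"
    by (intro nonneg_add nonneg_scaleR square_nonneg k) auto
  \<comment> \<open>Up to sign, u and v are twice the real and imaginary parts of w, and u^2 + v^2
    is twice \<open>w * star w + star w * w\<close>, that is 2 (m - k).\<close>
  also have "(1 / 2) *\<^sub>R (u * u + v * v) + k = m"
  proof -
    have "v * v = - ((w - star w) * (w - star w))"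
      by (simp add: v_def mult_scaleC_left mult_scaleC_right scaleC_scaleC scaleC_one
          complex_vector.scale_minus_left)
    then have "u * u + v * v = 2 *\<^sub>R (m - k)"
      using w by (simp add: u_def m_def algebra_simps scaleR_2)
    then show ?thesis by simp
  qed
  finally have m: "nonneg m" .
  have mw: "m * w = - (w * k)" by (simp add: m_def mult.assoc w)
  then have "m * m * w = w * (k * k)" by (metis minus_mult_minus mult.assoc mult_minus_right)
  moreover obtain r s where "0 < r" "nonneg_within r (m * m)" "0 < s" "nonneg_within s (k * k)"
    using square_nonneg m k nonneg_star unfolding nonneg_def by metis
  \<comment> \<open>Roots intertwine only when both are taken with the same radius.\<close>
  then have "0 < max r s" "nonneg_within (max r s) (m * m)" "nonneg_within (max r s) (k * k)"
    by (auto intro: nonneg_within_mono)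
  ultimately have "m * w = w * k"
    using psqrt_intertwines psqrt_square m k by metis
  with mw have "2 *\<^sub>R (w * k) = 0" by (simp only: scaleR_2 flip: eq_neg_iff_add_eq_0)
  then have "w * k = 0" by simp
  then have "k * k = 0" using w by (metis minus_mult_left mult.assoc mult_zero_right neg_equal_0_iff_equal)
  then show ?thesis using selfadj_square_eq_0[of k] k by (simp add: nonneg_star)
qed

text \<open>Let p = |h|, so that q = p - h is twice the negative part of h. From q h = - q p one
  gets q h q = - (g q)^2 with g the root of p, so \<open>star_mult_nonpos_eq_0\<close> applies to w
  = b q and forces g q = 0. Then q p and q h vanish, hence q^2, and h = |h|.\<close>

lemma nonneg_star_mult: "nonneg (star b * b)"
proof -
  define h where "h = star b * b"
  have h: "star h = h" by (simp add: h_def star_mult star_star)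
  obtain p where p: "nonneg p" "p * p = h * h"
      and p_comm: "\<And>w. h * h * w = w * (h * h) \<Longrightarrow> p * w = w * p"
    by (rule nonneg_sqrt[OF square_nonneg[OF h]]) blast
  have ph: "p * h = h * p" by (rule p_comm) (simp add: mult.assoc)
  obtain g where g: "nonneg g" "g * g = p" 
      and g_comm: "\<And>w. p * w = w * p \<Longrightarrow> g * w = w * g"
    by (rule nonneg_sqrt[OF p(1)]) blast
  define q where "q = p - h"
  have q: "star q = q" using p h by (simp add: q_def star_diff nonneg_star)
  have qh: "q * h = - (q * p)" by (simp add: q_def left_diff_distrib p ph)
  have pq: "p * q = q * p" by (simp add: q_def left_diff_distrib right_diff_distrib p ph)
  then have gq: "g * q = q * g" by (rule g_comm)
  have "star (b * q) * (b * q) = - ((g * q) * (g * q))"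
  proof -
    have "star (b * q) * (b * q) = q * h * q" by (simp add: star_mult q h_def mult.assoc)
    also have "\<dots> = - (q * (g * g) * q)" by (simp add: qh g)
    also have "\<dots> = - ((g * q) * (g * q))" by (metis gq mult.assoc)
    finally show ?thesis .
  qed
  moreover have star_gq: "star (g * q) = g * q" by (simp add: star_mult q g nonneg_star gq)
  ultimately have "(g * q) * (g * q) = 0"
    by (metis star_mult_nonpos_eq_0 square_nonneg)
  then have "g * q = 0" using star_gq selfadj_square_eq_0[of "g * q"] by simp
  then have "q * p = 0" by (metis g(2) pq mult.assoc mult_zero_right)
  then have "q * q = 0" using qh by (simp add: q_def right_diff_distrib)
  then have "q = 0" using q selfadj_square_eq_0[of q] by simp
  then show ?thesis using p by (simp add: q_def h_def)
qed

section \<open>Norm estimates from the order\<close>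

lemma nonneg_conjugate:
  assumes "nonneg a"
  shows "nonneg (star x * a * x)"
proof -
  obtain e where "nonneg e" "e * e = a" using nonneg_sqrt[OF assms] .
  then have "star x * a * x = star (e * x) * (e * x)" by (metis star_mult nonneg_star mult.assoc)
  then show ?thesis using nonneg_star_mult by metis
qed

text \<open>With R = |a + b|, the operator R - a has a root, and a + (R - a) is the scalar R. So the
  bound for sums of two squares, applied to the roots of a and of R - a after division by t,
  controls the root e of a.\<close>

lemma norm_le_norm_add_nonneg:
  assumes a: "nonneg a" and b: "nonneg b"
  shows "norm a \<le> norm (a + b)"
proof -
  define R where "R = norm (a + b)"
  obtain s where s: "0 < s" "nonneg_within s b" using b by (auto simp: nonneg_def)
  obtain e where e: "nonneg e" "e * e = a" using nonneg_sqrt[OF a] .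
  \<comment> \<open>This t makes the iteration applicable: t (1 - S) = s + a = (s - b) + (a + b) has
    norm at most s + R = t.\<close>
  define t where "t = R + s"
  have R: "0 \<le> R" and t: "0 < t" using s by (auto simp: R_def t_def add_nonneg_pos)
  define S where "S = (1 / t) *\<^sub>R (R *\<^sub>R id_blinfun - lmult a)"
  define E where "E = (1 / sqrt t) *\<^sub>R lmult e"
  have S_apply: "S x = (1 / t) *\<^sub>R (R *\<^sub>R x - a * x)" for x
    by (simp add: S_def blinfun.scaleR_left blinfun.diff_left)
  have EE: "(E o\<^sub>L E) x = (1 / t) *\<^sub>R (a * x)" for x
    using t by (simp add: E_def blinfun.scaleR_left e(2)[symmetric] mult.assoc)
  have S: "norm (id_blinfun - S) \<le> 1"
  proof (rule norm_blinfun_bound)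
    fix x
    have "x - S x = (1 / t) *\<^sub>R ((s *\<^sub>R x - b * x) + (a + b) * x)"
    proof -
      have "t *\<^sub>R S x = R *\<^sub>R x - a * x" using t by (simp add: S_apply)
      then have "t *\<^sub>R (x - S x) = (s *\<^sub>R x - b * x) + (a + b) * x"
        unfolding scaleR_diff_right[of t] by (simp add: t_def algebra_simps)
      moreover have "(1 / t) *\<^sub>R (t *\<^sub>R (x - S x)) = x - S x" using t by simp
      ultimately show ?thesis by (simp only:)
    qed
    moreover have "norm ((s *\<^sub>R x - b * x) + (a + b) * x) \<le> s * norm x + R * norm x"
      using s norm_mult_ineq[of "a + b" x]
      by (intro norm_triangle_mono) (auto simp: nonneg_within_def R_def)
    then have "norm ((s *\<^sub>R x - b * x) + (a + b) * x) \<le> t * norm x"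
      by (simp only: t_def distrib_right add.commute)
    ultimately have "norm (x - S x) \<le> norm x"
      using t by (simp only: norm_scaleR) (simp add: field_simps)
    then show "norm (blinfun_apply (id_blinfun - S) x) \<le> 1 * norm x"
      by (simp add: blinfun.diff_left)
  qed simp
  define g where "g = op_rt S"
  have E: "self.selfadj E"
    unfolding E_def using e by (intro self.selfadj_scaleR selfadj_lmult nonneg_star)
  have "self.selfadj g"
    unfolding g_def S_def using S a
    by (intro self.selfadj_op_rt self.selfadj_scaleR self.selfadj_diff self.selfadj_id selfadj_lmult
        nonneg_star) (auto simp: S_def)
  moreover have "S o\<^sub>L E = E o\<^sub>L S"
    by (rule blinfun_eqI)
      (simp add: S_apply E_def blinfun.scaleR_left e(2)[symmetric] mult.assoc
        scaleR_diff_right right_diff_distrib mult.commute[of t])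
  then have "E o\<^sub>L g = g o\<^sub>L E"
    unfolding g_def by (intro op.rt_intertwines[symmetric] op_rt_bound S)
  moreover have "(E o\<^sub>L E) + (g o\<^sub>L g) = (R / t) *\<^sub>R id_blinfun"
    unfolding g_def op.rt_mult_self[OF op_rt_bound[OF S]]
    by (rule blinfun_eqI) (use EE in \<open>simp add: blinfun.add_left blinfun.scaleR_left S_apply scaleR_diff_right\<close>)
  then have "norm ((E o\<^sub>L E) + (g o\<^sub>L g)) \<le> R / t"
    using R t norm_blinfun_id_le[where 'a = 'a] by (simp add: mult_left_le divide_right_mono)
  ultimately have "(norm (E x))\<^sup>2 \<le> R / t * (norm x)\<^sup>2" for x
    using E by (intro norm_apply_le_sum_squares)
  then have "(norm (e * x))\<^sup>2 / t \<le> R / t * (norm x)\<^sup>2" for x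
    using t by (simp add: E_def blinfun.scaleR_left power_divide)
  then have ex: "(norm (e * x))\<^sup>2 \<le> R * (norm x)\<^sup>2" for x
    using t by (simp add: field_simps)
  \<comment> \<open>The bound |e x|^2 <= R |x|^2 is applied twice, as a x = e (e x).\<close>
  have "norm (a * x) \<le> R * norm x" for x
  proof (rule power2_le_imp_le)
    have "(norm (a * x))\<^sup>2 = (norm (e * (e * x)))\<^sup>2" by (metis e(2) mult.assoc)
    also have "\<dots> \<le> R * (R * (norm x)\<^sup>2)" using ex R by (meson mult_left_mono order_trans)
    finally show "(norm (a * x))\<^sup>2 \<le> (R * norm x)\<^sup>2" by (simp add: power2_eq_square ac_simps)
  qed (use R in simp)
  then show ?thesis unfolding R_def[symmetric] by (rule mul.norm_le_of_mult[OF R])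
qed

text \<open>Any positive bound on the norm serves as radius, because a = e^2 with |e|^2 = |a|. A
  bounded sequence therefore shares one radius, which makes the cone closed.\<close>

lemma nonneg_within_norm:
  assumes "nonneg a" "norm a \<le> r" "0 < r"
  shows "nonneg_within r a"
proof -
  obtain e where e: "nonneg e" "e * e = a" using nonneg_sqrt[OF assms(1)] .
  have "(norm e)\<^sup>2 = norm a" using cstar_identity[of e] e by (simp add: nonneg_star)
  then show ?thesis using square_nonneg_within[of e r] e assms by (simp add: nonneg_star)
qed

lemma nonneg_LIMSEQ:
  assumes f: "f \<longlonglongrightarrow> a" and nonneg: "\<And>n. nonneg (f n)"
  shows "nonneg a"
proof -
  obtain r where r: "0 < r" "\<And>n. norm (f n) \<le> r"
    using convergent_imp_Bseq[OF convergentI[OF f]] BseqE by metis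
  then have within: "nonneg_within r (f n)" for n using nonneg nonneg_within_norm by blast
  have "star a = a"
    using LIMSEQ_unique[OF star_tendsto[OF f]] f nonneg by (simp add: nonneg_star)
  moreover have "norm (r *\<^sub>R x - a * x) \<le> r * norm x" for x
  proof (rule LIMSEQ_le_const2)
    show "(\<lambda>n. norm (r *\<^sub>R x - f n * x)) \<longlonglongrightarrow> norm (r *\<^sub>R x - a * x)"
      by (intro tendsto_intros f)
  qed (use within in \<open>auto simp: nonneg_within_def\<close>)
  ultimately show ?thesis using r by (auto simp: nonneg_def nonneg_within_def)
qed

text \<open>Conjugating h <= a by h gives h^3 <= h a h, hence |h^3| <= |h a| |h|.\<close>

lemma norm_square_le_norm_mult:
  assumes h: "nonneg h" and ah: "nonneg (a - h)"
  shows "(norm h)\<^sup>2 \<le> norm (h * a)"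
proof (cases "h = 0")
  case False
  have sh: "star h = h" using h by (rule nonneg_star)
  have "nonneg (h * h * h)" "nonneg (h * (a - h) * h)"
    using nonneg_conjugate[OF h, of h] nonneg_conjugate[OF ah, of h] sh by auto
  then have "norm (h * h * h) \<le> norm (h * h * h + h * (a - h) * h)"
    by (rule norm_le_norm_add_nonneg)
  also have "h * h * h + h * (a - h) * h = h * a * h" by (simp add: algebra_simps)
  also have "norm \<dots> \<le> norm (h * a) * norm h" by (rule norm_mult_ineq)
  finally have hhh: "norm (h * h * h) \<le> norm (h * a) * norm h" .
  have "((norm h)\<^sup>2)\<^sup>2 = norm ((h * h) * (h * h))"
    using cstar_identity[of h] cstar_identity[of "h * h"] by (simp add: sh star_mult)
  also have "\<dots> \<le> norm (h * h * h) * norm h"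
    using norm_mult_ineq[of "h * h * h" h] by (simp add: mult.assoc)
  also have "\<dots> \<le> norm (h * a) * norm h * norm h"
    using hhh by (rule mult_right_mono) simp
  finally have "(norm h)\<^sup>2 * (norm h)\<^sup>2 \<le> norm (h * a) * (norm h)\<^sup>2"
    by (simp add: power2_eq_square mult.assoc)
  then show ?thesis by (rule mult_right_le_imp_le) (use False in simp)
qed simp

section \<open>Operators on a Hilbert module\<close>

context hilbert_module
begin

lemma ip_diff_left: "ip (x - y) z = ip x z - ip y z"
  using ip_add_left[of "x - y" y z] by simp

lemma nonneg_ip_self: "nonneg (ip x x)"
proof -
  obtain b where "ip x x = star b * b" using ip_positive[of x] unfolding positive_in_def by blast
  then show ?thesis by (simp only: nonneg_star_mult)
qed

text \<open>
  For self-adjoint \<open>T\<close> and \<open>y = T x\<close>, the form \<open>4 \<langle>y, y\<rangle>\<close> is the polarised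
  \<open>\<langle>x + y, T (x + y)\<rangle> - \<langle>x - y, T (x - y)\<rangle>\<close>.
\<close>

lemma nonneg_form_bound:
  assumes T: "selfadj T"
    and lower: "\<And>x. nonneg (ip x x + ip x (T x))"
    and upper: "\<And>x. nonneg (ip x x - ip x (T x))"
  shows "nonneg (ip x x - ip (T x) (T x))"
proof -
  have sym: "ip (T y) z = ip y (T z)" for y z using T by (simp add: selfadj_def)
  define u where "u = x + T x"
  define v where "v = x - T x"
  have "nonneg ((1 / 2) *\<^sub>R ((ip u u - ip u (T u)) + (ip v v + ip v (T v))))"
    by (intro nonneg_scaleR nonneg_add lower upper) simp
  also have "(ip u u - ip u (T u)) + (ip v v + ip v (T v)) = 2 *\<^sub>R (ip x x - ip (T x) (T x))"
    by (simp add: u_def v_def ip_add_left ip_add_right ip_diff_left ip_diff_right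
        blinfun.add_right blinfun.diff_right sym scaleR_2)
  finally show ?thesis by simp
qed

lemma norm_le_1_of_form:
  assumes "selfadj T" "\<And>x. nonneg (ip x x + ip x (T x))" "\<And>x. nonneg (ip x x - ip x (T x))"
  shows "norm T \<le> 1"
proof (rule norm_blinfun_bound)
  fix x
  have "nonneg (ip x x - ip (T x) (T x))" using assms by (rule nonneg_form_bound)
  then have "norm (ip (T x) (T x)) \<le> norm (ip (T x) (T x) + (ip x x - ip (T x) (T x)))"
    by (rule norm_le_norm_add_nonneg[OF nonneg_ip_self])
  then have "(norm (T x))\<^sup>2 \<le> (norm x)\<^sup>2" by (simp add: norm_ip_self)
  then show "norm (T x) \<le> 1 * norm x" using power2_le_imp_le by simp
qed simp

lemma selfadj_complement: "selfadj T \<Longrightarrow> selfadj (id_blinfun - T)"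
  by (intro selfadj_diff selfadj_id)

context
  fixes S
  assumes S: "selfadj S"
    and lower: "\<And>x. nonneg (ip x (S x))"
    and upper: "\<And>x. nonneg (ip x x - ip x (S x))"
begin

lemma norm_form_contraction: "norm S \<le> 1"
  using S upper by (intro norm_le_1_of_form) (auto intro: nonneg_add nonneg_ip_self lower)

lemma norm_id_minus_form_contraction: "norm (id_blinfun - S) \<le> 1"
proof (rule norm_le_1_of_form)
  show "selfadj (id_blinfun - S)" by (rule selfadj_complement[OF S])
  show "nonneg (ip x x + ip x ((id_blinfun - S) x))" for x
    using nonneg_add[OF nonneg_ip_self[of x] upper[of x]] by (simp add: blinfun.diff_left ip_diff_right)
  show "nonneg (ip x x - ip x ((id_blinfun - S) x))" for x
    using lower by (simp add: blinfun.diff_left ip_diff_right)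
qed

lemma nonneg_form_minus_square: "nonneg (ip x (S x) - ip (S x) (S x))"
proof -
  let ?E = "id_blinfun - 2 *\<^sub>R S"
  have E: "?E y = y - 2 *\<^sub>R S y" for y by (simp add: blinfun.diff_left blinfun.scaleR_left)
  have sym: "ip (S y) z = ip y (S z)" for y z using S by (simp add: selfadj_def)
  have "nonneg (ip x x - ip (?E x) (?E x))"
  proof (rule nonneg_form_bound)
    show "selfadj ?E" by (intro selfadj_complement selfadj_scaleR S)
    show "nonneg (ip y y + ip y (?E y))" for y
    proof -
      have "ip y y + ip y (?E y) = 2 *\<^sub>R (ip y y - ip y (S y))"
        by (simp only: E ip_diff_right ip_scaleR_right scaleR_diff_right) (simp add: scaleR_2)
      then show ?thesis using nonneg_scaleR[OF upper[of y], of 2] by (simp only:)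
    qed
    show "nonneg (ip y y - ip y (?E y))" for y
      using nonneg_scaleR[OF lower[of y], of 2]
      by (simp add: E ip_diff_right ip_scaleR_right)
  qed
  then have "nonneg ((1 / 4) *\<^sub>R (ip x x - ip (?E x) (?E x)))" by (rule nonneg_scaleR) simp
  also have "ip x x - ip (?E x) (?E x) = 4 *\<^sub>R (ip x (S x) - ip (S x) (S x))"
  proof -
    have "ip (?E x) (?E x) = ip x x - 2 *\<^sub>R ip x (S x) - (2 *\<^sub>R ip x (S x) - 2 *\<^sub>R 2 *\<^sub>R ip (S x) (S x))"
      by (simp only: E ip_diff_left ip_diff_right ip_scaleR_left ip_scaleR_right sym scaleR_diff_right)
    moreover have "2 *\<^sub>R p + 2 *\<^sub>R p = 4 *\<^sub>R p" for p :: 'a by (simp flip: scaleR_add_left)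
    ultimately show ?thesis by (simp add: scaleR_diff_right)
  qed
  finally show ?thesis by simp
qed

end

lemma act_zero_left: "0 \<cdot> a = 0"
  using act_add_left[of 0 0 a] by simp

lemma theta_add_left: "theta (y + z) x = theta y x + theta z x"
  by (rule blinfun_eqI) (simp add: theta_apply act_add_left blinfun.add_left)

lemma theta_diff_left: "theta (y - z) x = theta y x - theta z x"
  using theta_add_left[of "y - z" z x] by simp

lemma theta_scaleC_left: "theta (c *\<^sub>C y) x = c *\<^sub>C theta y x"
  by (rule blinfun_eqI) (simp add: theta_apply act_scaleC_left scaleC_blinfun.rep_eq)

lemma norm_theta_le: "norm (theta y x) \<le> norm y * (4 * norm x)"
proof (rule norm_blinfun_bound)
  fix z
  have "norm (y \<cdot> ip x z) \<le> norm y * norm (ip x z)" by (rule norm_act_le)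
  also have "\<dots> \<le> norm y * (4 * (norm x * norm z))" by (intro mult_left_mono norm_ip_le) simp
  finally show "norm (theta y x z) \<le> norm y * (4 * norm x) * norm z"
    by (simp add: theta_apply mult.assoc)
qed simp

lemma selfadj_theta: "selfadj (theta x x)"
  by (simp add: selfadj_def theta_apply ip_act_left ip_act_right ip_star)

lemma theta_in_finite_rank: "theta y x \<in> finite_rank_ops"
  unfolding finite_rank_ops_def by (rule complex_vector.span_base) blast

lemma zero_in_finite_rank: "0 \<in> finite_rank_ops"
  unfolding finite_rank_ops_def by (rule complex_vector.span_zero)

lemma add_in_finite_rank: "S \<in> finite_rank_ops \<Longrightarrow> T \<in> finite_rank_ops \<Longrightarrow> S + T \<in> finite_rank_ops"
  unfolding finite_rank_ops_def by (rule complex_vector.span_add)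

lemma scaleR_in_finite_rank: "T \<in> finite_rank_ops \<Longrightarrow> r *\<^sub>R T \<in> finite_rank_ops"
  unfolding finite_rank_ops_def scaleR_scaleC by (rule complex_vector.span_scale)

lemma finite_rank_induct [consumes 1, case_names zero theta_add]:
  assumes "T \<in> finite_rank_ops" "P 0" "\<And>y x T. P T \<Longrightarrow> P (theta y x + T)"
  shows "P T"
  using assms(1) unfolding finite_rank_ops_def
proof (induction rule: complex_vector.span_induct_alt)
  case (step c U V)
  then obtain y x where "U = theta y x" by blast
  with assms(3)[OF step.IH] show ?case by (metis theta_scaleC_left)
qed (rule assms)

lemma finite_rank_act:
  assumes "T \<in> finite_rank_ops"
  shows "T (z \<cdot> a) = T z \<cdot> a"
  using assms
  by (induction rule: finite_rank_induct)
    (simp_all add: theta_apply blinfun.add_left act_add_left act_zero_left ip_act_right act_mult)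

lemma compose_theta:
  assumes "T \<in> finite_rank_ops"
  shows "T o\<^sub>L theta y x = theta (T y) x"
  by (rule blinfun_eqI) (simp add: theta_apply finite_rank_act[OF assms])

lemma compose_in_finite_rank:
  assumes "S \<in> finite_rank_ops" "T \<in> finite_rank_ops"
  shows "S o\<^sub>L T \<in> finite_rank_ops"
  using assms(2)
proof (induction rule: finite_rank_induct)
  case (theta_add y x T)
  then show ?case
    by (simp add: op.add_right compose_theta[OF assms(1)] add_in_finite_rank theta_in_finite_rank)
qed (simp add: zero_in_finite_rank)

lemma finite_rank_subset_compact: "T \<in> finite_rank_ops \<Longrightarrow> T \<in> compact_ops"
  unfolding compact_ops_def using closure_subset by blast

lemma positive_in_compact_ops:
  assumes T: "T \<in> finite_rank_ops" "selfadj T" "norm (id_blinfun - T) \<le> 1"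
  shows "positive_in compact_ops (o\<^sub>L) adjoint_op T"
proof -
  have "op_rt T \<in> compact_ops"
    unfolding compact_ops_def
    using T zero_in_finite_rank add_in_finite_rank scaleR_in_finite_rank compose_in_finite_rank
    by (intro op.rt_in_closure op_rt_bound) auto
  moreover have "op_rt T o\<^sub>L op_rt T = T" by (intro op.rt_mult_self op_rt_bound T)
  moreover have "adjoint_op (op_rt T) = op_rt T" by (intro selfadj_adjoint_op selfadj_op_rt T)
  ultimately show ?thesis unfolding positive_in_def by (intro bexI[of _ "op_rt T"]) simp_all
qed

lemma compose_tendsto_compact:
  assumes S: "\<And>n. S n \<in> finite_rank_ops" "\<And>n. norm (S n) \<le> 1" "\<And>y. (\<lambda>n. S n y) \<longlonglongrightarrow> y"
    and T: "T \<in> compact_ops"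
  shows "(\<lambda>n. S n o\<^sub>L T) \<longlonglongrightarrow> T"
proof (rule LIMSEQ_I)
  have finite_rank: "(\<lambda>n. S n o\<^sub>L U) \<longlonglongrightarrow> U" if "U \<in> finite_rank_ops" for U
    using that
  proof (induction rule: finite_rank_induct)
    case (theta_add y x U)
    have "(\<lambda>n. norm (S n y - y) * (4 * norm x)) \<longlonglongrightarrow> 0"
      using S(3)[of y] by (intro tendsto_mult_left_zero) (simp add: tendsto_norm_zero_iff LIM_zero_iff)
    then have "(\<lambda>n. theta (S n y - y) x) \<longlonglongrightarrow> 0"
      by (rule Lim_null_comparison[rotated]) (simp add: norm_theta_le)
    then have "(\<lambda>n. theta (S n y) x) \<longlonglongrightarrow> theta y x"
      by (simp add: theta_diff_left LIM_zero_iff)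
    then have "(\<lambda>n. theta (S n y) x + (S n o\<^sub>L U)) \<longlonglongrightarrow> theta y x + U"
      using theta_add by (rule tendsto_add)
    then show ?case by (simp add: op.add_right compose_theta[OF S(1)])
  qed simp
  fix e :: real assume "0 < e"
  then have "0 < e / 3" by simp
  then obtain U where U: "U \<in> finite_rank_ops" "norm (T - U) < e / 3"
    using T unfolding compact_ops_def closure_approachable dist_norm norm_minus_commute[of _ T]
    by blast
  obtain M where M: "\<And>n. n \<ge> M \<Longrightarrow> norm ((S n o\<^sub>L U) - U) < e / 3"
    using LIMSEQ_D[OF finite_rank[OF U(1)], of "e / 3"] \<open>0 < e\<close> by auto
  have "norm ((S n o\<^sub>L T) - T) < e" if "n \<ge> M" for n
  proof -
    have "(S n o\<^sub>L T) - T = (S n o\<^sub>L (T - U)) + ((S n o\<^sub>L U) - U) + (U - T)"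
      by (simp add: op.diff_right)
    also have "norm \<dots> \<le> norm (S n o\<^sub>L (T - U)) + norm ((S n o\<^sub>L U) - U) + norm (U - T)"
      by (intro norm_triangle_mono order_refl)
    also have "norm (S n o\<^sub>L (T - U)) \<le> norm (T - U)"
      using order_trans[OF norm_blinfun_compose mult_left_le_one_le[OF norm_ge_zero norm_ge_zero S(2)]] .
    finally show ?thesis using U(2) M[OF that] by (simp add: norm_minus_commute)
  qed
  then show "\<exists>M. \<forall>n\<ge>M. norm ((S n o\<^sub>L T) - T) < e" by blast
qed

definition frame_op :: "(nat \<Rightarrow> 'x) \<Rightarrow> nat \<Rightarrow> 'x \<Rightarrow>\<^sub>L 'x"
  where "frame_op xs N = (\<Sum>n\<le>N. theta (xs n) (xs n))"

lemma ip_frame_op: "ip x (frame_op xs N y) = (\<Sum>n\<le>N. ip x (xs n) * ip (xs n) y)"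
proof -
  have "ip x (theta z z y) = ip x z * ip z y" for z by (simp add: theta_apply ip_act_right)
  then show ?thesis
    unfolding frame_op_def
    by (induction N) (simp_all add: blinfun.add_left ip_add_right)
qed

lemma selfadj_frame_op: "selfadj (frame_op xs N)"
  unfolding frame_op_def by (induction N) (simp_all add: selfadj_theta selfadj_add)

lemma frame_op_in_finite_rank: "frame_op xs N \<in> finite_rank_ops"
  unfolding frame_op_def
  by (induction N) (simp_all add: theta_in_finite_rank add_in_finite_rank)

lemma nonneg_ip_mult_ip: "nonneg (ip x z * ip z x)"
  using nonneg_star_mult[of "ip z x"] by (simp add: ip_star)

lemma nonneg_ip_frame_op: "nonneg (ip x (frame_op xs N x))"
  unfolding ip_frame_op by (intro nonneg_sum nonneg_ip_mult_ip)

lemma parseval_frame_iff: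
  "parseval_frame xs \<longleftrightarrow> (\<forall>x. (\<lambda>N. ip x (frame_op xs N x)) \<longlonglongrightarrow> ip x x)"
  by (simp add: parseval_frame_def sums_def_le ip_frame_op)

lemma parseval_frame_imp_approximate_unit:
  assumes "parseval_frame xs"
  shows "approximate_unit compact_ops (o\<^sub>L) adjoint_op sequentially (frame_op xs)"
proof -
  note S = selfadj_frame_op nonneg_ip_frame_op
  have lim: "(\<lambda>N. ip x (frame_op xs N x)) \<longlonglongrightarrow> ip x x" for x
    using assms by (simp add: parseval_frame_iff)
  have upper: "nonneg (ip x x - ip x (frame_op xs N x))" for N x
  proof (rule nonneg_LIMSEQ)
    show "(\<lambda>k. ip x (frame_op xs (k + N) x) - ip x (frame_op xs N x))
        \<longlonglongrightarrow> ip x x - ip x (frame_op xs N x)"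
      by (intro tendsto_diff tendsto_const LIMSEQ_ignore_initial_segment[OF lim])
    fix k
    show "nonneg (ip x (frame_op xs (k + N) x) - ip x (frame_op xs N x))"
    proof (induction k)
      case (Suc k)
      then have "nonneg ((ip x (frame_op xs (k + N) x) - ip x (frame_op xs N x))
          + ip x (xs (Suc (k + N))) * ip (xs (Suc (k + N))) x)"
        by (rule nonneg_add[OF _ nonneg_ip_mult_ip])
      then show ?case by (simp add: ip_frame_op diff_add_eq)
    qed (simp add: nonneg_zero)
  qed
  have norm: "norm (frame_op xs N) \<le> 1" for N by (intro norm_form_contraction S upper)
  have strong: "(\<lambda>N. frame_op xs N y) \<longlonglongrightarrow> y" for y
  proof -
    have le: "(norm (y - frame_op xs N y))\<^sup>2 \<le> norm (ip y y - ip y (frame_op xs N y))" for N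
    proof -
      let ?D = "id_blinfun - frame_op xs N"
      have D: "?D z = z - frame_op xs N z" for z by (simp add: blinfun.diff_left)
      have "nonneg (ip y (?D y) - ip (?D y) (?D y))"
        by (intro nonneg_form_minus_square selfadj_complement S(1))
          (simp_all add: D ip_diff_right upper S(2))
      then have "norm (ip (?D y) (?D y)) \<le> norm (ip (?D y) (?D y) + (ip y (?D y) - ip (?D y) (?D y)))"
        by (rule norm_le_norm_add_nonneg[OF nonneg_ip_self])
      then have "(norm (?D y))\<^sup>2 \<le> norm (ip y (?D y))" by (simp add: norm_ip_self)
      then show ?thesis by (simp add: D ip_diff_right)
    qed
    have "(\<lambda>N. norm (ip y y - ip y (frame_op xs N y))) \<longlonglongrightarrow> 0"
      using tendsto_norm_zero[OF LIM_zero[OF lim[of y]]] by (simp add: norm_minus_commute)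
    then have "(\<lambda>N. (norm (y - frame_op xs N y))\<^sup>2) \<longlonglongrightarrow> 0"
      by (rule tendsto_sandwich[OF _ _ tendsto_const, rotated 2]) (simp_all add: le)
    then have "(\<lambda>N. norm (y - frame_op xs N y)) \<longlonglongrightarrow> 0" by (simp add: power_tendsto_0_iff)
    then have "(\<lambda>N. norm (frame_op xs N y - y)) \<longlonglongrightarrow> 0" by (simp add: norm_minus_commute)
    then show ?thesis by (rule LIM_zero_cancel[OF tendsto_norm_zero_cancel])
  qed
  show ?thesis
    unfolding approximate_unit_def
  proof (intro conjI allI ballI)
    show "positive_in compact_ops (o\<^sub>L) adjoint_op (frame_op xs N)" for N
      by (intro positive_in_compact_ops frame_op_in_finite_rank norm_id_minus_form_contraction S upper)
    show "(\<lambda>N. frame_op xs N o\<^sub>L T) \<longlonglongrightarrow> T" if "T \<in> compact_ops" for T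
      using frame_op_in_finite_rank norm strong that by (rule compose_tendsto_compact)
  qed (simp_all add: norm frame_op_in_finite_rank finite_rank_subset_compact)
qed

text \<open>
  With \<open>a = \<langle>x, x\<rangle>\<close> and \<open>h\<^sub>N = \<langle>x, (1 - S\<^sub>N) x\<rangle>\<close>, the hypothesis for the compact operator
  \<open>theta x x\<close>, evaluated at \<open>x\<close>, gives \<open>h\<^sub>N a \<longlonglongrightarrow> 0\<close>, and \<open>0 \<le> h\<^sub>N \<le> a\<close>.
\<close>

lemma approximate_unit_imp_parseval_frame:
  assumes unit: "approximate_unit compact_ops (o\<^sub>L) adjoint_op sequentially (frame_op xs)"
  shows "parseval_frame xs"
  unfolding parseval_frame_iff
proof
  fix x
  define a where "a = ip x x"
  define h where "h N = a - ip x (frame_op xs N x)" for N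
  have nonneg_h: "nonneg (h N)" for N
  proof -
    let ?D = "id_blinfun - frame_op xs N"
    have "norm (frame_op xs N) \<le> 1" using unit by (simp add: approximate_unit_def)
    then have D: "norm (id_blinfun - ?D) \<le> 1" by (simp add: diff_diff_eq2)
    have "selfadj (op_rt ?D)" by (intro selfadj_op_rt D selfadj_complement selfadj_frame_op)
    then have "ip (op_rt ?D x) (op_rt ?D x) = ip x ((op_rt ?D o\<^sub>L op_rt ?D) x)"
      by (simp add: selfadj_def)
    also have "op_rt ?D o\<^sub>L op_rt ?D = ?D" by (intro op.rt_mult_self op_rt_bound D)
    finally have "ip (op_rt ?D x) (op_rt ?D x) = h N"
      by (simp add: h_def a_def blinfun.diff_left ip_diff_right)
    then show ?thesis using nonneg_ip_self[of "op_rt ?D x"] by (simp only:)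
  qed
  have "(\<lambda>N. frame_op xs N o\<^sub>L theta x x) \<longlonglongrightarrow> theta x x"
    using unit theta_in_finite_rank finite_rank_subset_compact
    by (simp add: approximate_unit_def)
  then have "(\<lambda>N. ip x ((frame_op xs N o\<^sub>L theta x x) x)) \<longlonglongrightarrow> ip x (theta x x x)"
    by (intro bounded_bilinear.tendsto[OF bounded_bilinear_ip] blinfun.tendsto tendsto_const)
  then have "(\<lambda>N. ip x (frame_op xs N x) * a) \<longlonglongrightarrow> a * a"
    by (simp add: theta_apply finite_rank_act[OF frame_op_in_finite_rank] ip_act_right a_def)
  then have "(\<lambda>N. a * a - ip x (frame_op xs N x) * a) \<longlonglongrightarrow> a * a - a * a"
    by (intro tendsto_diff tendsto_const)
  then have "(\<lambda>N. norm (h N * a)) \<longlonglongrightarrow> 0"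
    by (simp add: h_def left_diff_distrib tendsto_norm_zero)
  moreover have "(norm (h N))\<^sup>2 \<le> norm (h N * a)" for N
    by (rule norm_square_le_norm_mult[OF nonneg_h]) (simp add: h_def nonneg_ip_frame_op)
  then have "\<forall>\<^sub>F N in sequentially. norm ((norm (h N))\<^sup>2) \<le> norm (h N * a)" by simp
  ultimately have "(\<lambda>N. (norm (h N))\<^sup>2) \<longlonglongrightarrow> 0" by (rule Lim_null_comparison[rotated])
  then have "h \<longlonglongrightarrow> 0" by (simp add: power_tendsto_0_iff tendsto_norm_zero_iff)
  then have "(\<lambda>N. a - h N) \<longlonglongrightarrow> a - 0" by (intro tendsto_diff tendsto_const)
  then show "(\<lambda>N. ip x (frame_op xs N x)) \<longlonglongrightarrow> ip x x" by (simp add: h_def a_def)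
qed

end

theorem proposition2p3:
  fixes act :: "'x::{complex_normed_vector, complete_space} \<Rightarrow> 'a::cstar_algebra \<Rightarrow> 'x"
    and ip :: "'x \<Rightarrow> 'x \<Rightarrow> 'a"
    and xs :: "nat \<Rightarrow> 'x"
  assumes "hilbert_module act ip"
  shows "hilbert_module.parseval_frame ip xs \<longleftrightarrow>
    approximate_unit (hilbert_module.compact_ops act ip) (o\<^sub>L) (hilbert_module.adjoint_op ip)
      sequentially (\<lambda>N. \<Sum>n\<le>N. hilbert_module.theta act ip (xs n) (xs n))"
proof -
  interpret hilbert_module act ip by (rule assms)
  show ?thesis
    using parseval_frame_imp_approximate_unit approximate_unit_imp_parseval_frame
    unfolding frame_op_def by blast
qed

end
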